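(* The $C^\ast$-diagonals $\mathcal{C}=C^\ast\{A_v,B_{\tilde v}\mid v\in V,\ \tilde v\in\tilde V\}$ (generated by the star and face operators of the toric code) and $\mathcal{D}=C^\ast\{\sigma^z_e\mid e\in E\}$ (the standard diagonal) of $\mathcal{A}\simeq M_{2^\infty}$ are equivalent, i.e. there is a $\ast$-isomorphism $\mathcal{C}\to\mathcal{D}$ that is the restriction of a $\ast$-automorphism of $\mathcal{A}$.
   Context: Let $\mathcal{L}$ be the infinite planar square lattice (vertex set $V=\mathbb{Z}^2$, nearest-neighbour edges), with set of unoriented edges $E$. Let $\tilde V$ be the set of faces of $\mathcal{L}$ (equivalently, the vertices of the dual lattice); for $\tilde v\in\tilde V$ write $e\in\tilde v$ if $e\in E$ is one of the four edges bounding the face $\tilde v$; for $v\in V$ write $e\ni v$ if $v$ is an endpoint of $e$. Each edge $e$ carries the matrix algebra $\mathcal{A}_e=M_2(\mathbb{C})$, with Pauli matrices $\sigma^x_e,\sigma^z_e\in\mathcal{A}_e$. For finite $\Lambda\subset E$, $\mathcal{A}_\Lambda=\bigotimes_{e\in\Lambda}\mathcal{A}_e$, with the natural inclusions $\mathcal{A}_{\Lambda'}\subset\mathcal{A}_\Lambda$, $a\mapsto a\otimes\mathbf{1}_{\Lambda\setminus\Lambda'}$, for $\Lambda'\subset\Lambda$; $\mathcal{A}$ is the $C^\ast$-completion of $\bigcup_\Lambda\mathcal{A}_\Lambda$, which is isomorphic to the UHF algebra $M_{2^\infty}$. The star and face operators are $A_v=\prod_{e\ni v}\sigma^x_e$ and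 $B_{\tilde v}=\prod_{e\in\tilde v}\sigma^z_e$; they are pairwise commuting self-adjoint unitaries. A sub-$C^\ast$-algebra $\mathcal{B}$ of a unital $C^\ast$-algebra $\mathcal{A}$ is a $C^\ast$-diagonal if (1) $\mathcal{B}$ is a regular masa: $\mathcal{B}$ is abelian, equals its own relative commutant in $\mathcal{A}$, and the set of normalizers $\{n\in\mathcal{A}\mid n^\ast\mathcal{B}n\subset\mathcal{B},\ n\mathcal{B}n^\ast\subset\mathcal{B}\}$ generates $\mathcal{A}$ as a $C^\ast$-algebra; and (2) every pure state on $\mathcal{B}$ extends uniquely to a pure state on $\mathcal{A}$. Two $C^\ast$-diagonals of $\mathcal{A}$ are (automorphism) equivalent if they are isomorphic as $C^\ast$-algebras and one of their isomorphisms lifts to an automorphism of $\mathcal{A}$. *)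

theory Defs
  imports "HOL-Analysis.Analysis"
begin

section \<open>Unital $C^*$-algebras\<close>

class cstar_algebra = real_normed_algebra_1 + banach +
  fixes scaleC :: "complex \<Rightarrow> 'a \<Rightarrow> 'a"  (infixr \<open>*\<^sub>C\<close> 75)
    and adj :: "'a \<Rightarrow> 'a"
  assumes scaleC_add_right: "c *\<^sub>C (x + y) = c *\<^sub>C x + c *\<^sub>C y"
    and scaleC_add_left: "(c + d) *\<^sub>C x = c *\<^sub>C x + d *\<^sub>C x"
    and scaleC_scaleC: "c *\<^sub>C d *\<^sub>C x = (c * d) *\<^sub>C x"
    and scaleR_scaleC: "r *\<^sub>R x = complex_of_real r *\<^sub>C x"
    and mult_scaleC_left: "(c *\<^sub>C x) * y = c *\<^sub>C (x * y)"
    and mult_scaleC_right: "x * (c *\<^sub>C y) = c *\<^sub>C (x * y)"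
    and norm_scaleC: "norm (c *\<^sub>C x) = cmod c * norm x"
    and adj_add: "adj (x + y) = adj x + adj y"
    and adj_scaleC: "adj (c *\<^sub>C x) = cnj c *\<^sub>C adj x"
    and adj_mult: "adj (x * y) = adj y * adj x"
    and adj_adj: "adj (adj x) = x"
    and cstar_identity: "norm (adj x * x) = (norm x)\<^sup>2"

definition cstar_subalgebra :: "'a::cstar_algebra set \<Rightarrow> bool" where
  "cstar_subalgebra B \<longleftrightarrow>
     0 \<in> B \<and> closed B \<and>
     (\<forall>x\<in>B. \<forall>y\<in>B. x + y \<in> B \<and> x * y \<in> B) \<and>
     (\<forall>c. \<forall>x\<in>B. c *\<^sub>C x \<in> B) \<and>
     (\<forall>x\<in>B. adj x \<in> B)"

definition star_iso :: "'a::cstar_algebra set \<Rightarrow> 'b::cstar_algebra set \<Rightarrow> ('a \<Rightarrow> 'b) \<Rightarrow> bool" where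
  "star_iso B B' \<Phi> \<longleftrightarrow>
     bij_betw \<Phi> B B' \<and>
     (\<forall>x\<in>B. \<forall>y\<in>B. \<Phi> (x + y) = \<Phi> x + \<Phi> y \<and> \<Phi> (x * y) = \<Phi> x * \<Phi> y) \<and>
     (\<forall>c. \<forall>x\<in>B. \<Phi> (c *\<^sub>C x) = c *\<^sub>C \<Phi> x) \<and>
     (\<forall>x\<in>B. \<Phi> (adj x) = adj (\<Phi> x))"

definition relative_commutant :: "'a::cstar_algebra set \<Rightarrow> 'a set" where
  "relative_commutant B = {a. \<forall>b\<in>B. a * b = b * a}"

definition normalizers :: "'a::cstar_algebra set \<Rightarrow> 'a set" where
  "normalizers B = {n. (\<forall>b\<in>B. adj n * b * n \<in> B) \<and> (\<forall>b\<in>B. n * b * adj n \<in> B)}"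

definition regular_masa :: "'a::cstar_algebra set \<Rightarrow> bool" where
  "regular_masa B \<longleftrightarrow>
     cstar_subalgebra B \<and>
     (\<forall>x\<in>B. \<forall>y\<in>B. x * y = y * x) \<and>
     relative_commutant B = B \<and>
     cstar_subalgebra hull (normalizers B) = UNIV"

text \<open>States on a sub-$C^*$-algebra \<open>B\<close> containing the unit of the ambient algebra.
  Functionals are HOL functions on the whole type, of which only the values on \<open>B\<close> matter.\<close>

definition state_on :: "'a::cstar_algebra set \<Rightarrow> ('a \<Rightarrow> complex) \<Rightarrow> bool" where
  "state_on B \<phi> \<longleftrightarrow>
     (\<forall>x\<in>B. \<forall>y\<in>B. \<phi> (x + y) = \<phi> x + \<phi> y) \<and>
     (\<forall>c. \<forall>x\<in>B. \<phi> (c *\<^sub>C x) = c * \<phi> x) \<and>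
     (\<forall>x\<in>B. \<phi> (adj x * x) \<in> \<real>\<^sub>\<ge>\<^sub>0) \<and>
     \<phi> 1 = 1"

definition pure_state_on :: "'a::cstar_algebra set \<Rightarrow> ('a \<Rightarrow> complex) \<Rightarrow> bool" where
  "pure_state_on B \<phi> \<longleftrightarrow>
     state_on B \<phi> \<and>
     (\<forall>\<psi> \<omega> t. state_on B \<psi> \<longrightarrow> state_on B \<omega> \<longrightarrow> 0 < t \<longrightarrow> t < 1 \<longrightarrow>
        (\<forall>b\<in>B. \<phi> b = complex_of_real t * \<psi> b + complex_of_real (1 - t) * \<omega> b) \<longrightarrow>
        (\<forall>b\<in>B. \<psi> b = \<phi> b \<and> \<omega> b = \<phi> b))"

text \<open>The ambient unital $C^*$-algebra is the whole type. A masa automatically contains the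
  unit, so \<open>state_on\<close> is only used where it is meaningful.\<close>

definition cstar_diagonal :: "'a::cstar_algebra set \<Rightarrow> bool" where
  "cstar_diagonal B \<longleftrightarrow>
     regular_masa B \<and>
     (\<forall>\<phi>. pure_state_on B \<phi> \<longrightarrow>
        (\<exists>!\<psi>. pure_state_on UNIV \<psi> \<and> (\<forall>b\<in>B. \<psi> b = \<phi> b)))"

definition automorphism_equivalent :: "'a::cstar_algebra set \<Rightarrow> 'a set \<Rightarrow> bool" where
  "automorphism_equivalent B B' \<longleftrightarrow>
     (\<exists>\<Phi> \<alpha>. star_iso B B' \<Phi> \<and> star_iso UNIV UNIV \<alpha> \<and> (\<forall>b\<in>B. \<alpha> b = \<Phi> b))"


section \<open>The square lattice\<close>

type_synonym vertex = "int \<times> int"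
type_synonym edge = "vertex set"
type_synonym face = "int \<times> int"

definition lattice_edges :: "edge set" where
  "lattice_edges = {{v, w} | v w. \<bar>fst v - fst w\<bar> + \<bar>snd v - snd w\<bar> = 1}"

definition star_edges :: "vertex \<Rightarrow> edge set" where
  "star_edges v = {e \<in> lattice_edges. v \<in> e}"

lemma star_edges_eq:
  "star_edges (x, y) = {{(x, y), (x + 1, y)}, {(x, y), (x - 1, y)},
                        {(x, y), (x, y + 1)}, {(x, y), (x, y - 1)}}"
proof
  show "star_edges (x, y) \<subseteq> {{(x, y), (x + 1, y)}, {(x, y), (x - 1, y)},
                               {(x, y), (x, y + 1)}, {(x, y), (x, y - 1)}}"
  proof
    fix e assume "e \<in> star_edges (x, y)"
    then obtain v w where vw: "e = {v, w}" "\<bar>fst v - fst w\<bar> + \<bar>snd v - snd w\<bar> = 1" "(x, y) \<in> e"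
      by (auto simp: star_edges_def lattice_edges_def)
    have "\<exists>a b. e = {(x, y), (a, b)} \<and> \<bar>x - a\<bar> + \<bar>y - b\<bar> = 1"
    proof (cases "v = (x, y)")
      case True
      then show ?thesis using vw by (cases w) auto
    next
      case False
      then have "w = (x, y)" using vw by auto
      then show ?thesis
        using vw by (intro exI[of _ "fst v"] exI[of _ "snd v"]) (auto simp: insert_commute)
    qed
    then obtain a b where e: "e = {(x, y), (a, b)}" and d: "\<bar>x - a\<bar> + \<bar>y - b\<bar> = 1"
      by blast
    from d have "a = x + 1 \<and> b = y \<or> a = x - 1 \<and> b = y \<or> a = x \<and> b = y + 1 \<or> a = x \<and> b = y - 1"
      by arith
    with e show "e \<in> {{(x, y), (x + 1, y)}, {(x, y), (x - 1, y)},
                      {(x, y), (x, y + 1)}, {(x, y), (x, y - 1)}}"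
      by auto
  qed
qed (force simp: star_edges_def lattice_edges_def)

text \<open>A face is named by its lower left corner.\<close>

definition face_edges :: "face \<Rightarrow> edge set" where
  "face_edges f = (case f of (x, y) \<Rightarrow>
     {{(x, y), (x + 1, y)}, {(x + 1, y), (x + 1, y + 1)},
      {(x, y + 1), (x + 1, y + 1)}, {(x, y), (x, y + 1)}})"


section \<open>The local algebras\<close>

text \<open>$\bigotimes_{e\in\Lambda} M_2(\mathbf C)$ is realised as the algebra of matrices indexed by
  \<open>configs \<Lambda>\<close>, the standard basis labels of $\bigotimes_{e\in\Lambda}\mathbf C^2$: the pure
  tensor of the matrices \<open>a e\<close> is their Kronecker product. Matrix entries outside
  \<open>configs \<Lambda> \<times> configs \<Lambda>\<close> are required to vanish, so that equality is equality of functions.\<close>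

type_synonym config = "edge \<Rightarrow> 2"
type_synonym local_op = "config \<Rightarrow> config \<Rightarrow> complex"

definition configs :: "edge set \<Rightarrow> config set" where
  "configs \<Lambda> = \<Lambda> \<rightarrow>\<^sub>E UNIV"

definition local_alg :: "edge set \<Rightarrow> local_op set" where
  "local_alg \<Lambda> = {m. \<forall>s t. m s t \<noteq> 0 \<longrightarrow> s \<in> configs \<Lambda> \<and> t \<in> configs \<Lambda>}"

definition local_add :: "local_op \<Rightarrow> local_op \<Rightarrow> local_op" where
  "local_add m n = (\<lambda>s t. m s t + n s t)"

definition local_scale :: "complex \<Rightarrow> local_op \<Rightarrow> local_op" where
  "local_scale c m = (\<lambda>s t. c * m s t)"

definition local_mult :: "edge set \<Rightarrow> local_op \<Rightarrow> local_op \<Rightarrow> local_op" where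
  "local_mult \<Lambda> m n = (\<lambda>s t. \<Sum>u\<in>configs \<Lambda>. m s u * n u t)"

definition local_adj :: "local_op \<Rightarrow> local_op" where
  "local_adj m = (\<lambda>s t. cnj (m t s))"

definition pure_tensor :: "edge set \<Rightarrow> (edge \<Rightarrow> complex^2^2) \<Rightarrow> local_op" where
  "pure_tensor \<Lambda> a = (\<lambda>s t. if s \<in> configs \<Lambda> \<and> t \<in> configs \<Lambda>
                            then \<Prod>e\<in>\<Lambda>. a e $ s e $ t e else 0)"

definition local_one :: "edge set \<Rightarrow> local_op" where
  "local_one \<Lambda> = pure_tensor \<Lambda> (\<lambda>_. mat 1)"

text \<open>The inclusion $a \mapsto a \otimes \mathbf 1_{\Lambda\setminus\Lambda'}$ for
  $\Lambda'\subseteq\Lambda$; see \<open>inclusion_pure_tensor\<close> below.\<close>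

definition inclusion :: "edge set \<Rightarrow> edge set \<Rightarrow> local_op \<Rightarrow> local_op" where
  "inclusion \<Lambda>' \<Lambda> m = (\<lambda>s t.
     if s \<in> configs \<Lambda> \<and> t \<in> configs \<Lambda>
     then m (restrict s \<Lambda>') (restrict t \<Lambda>')
          * local_one (\<Lambda> - \<Lambda>') (restrict s (\<Lambda> - \<Lambda>')) (restrict t (\<Lambda> - \<Lambda>'))
     else 0)"

lemma restrict_in_configs: "restrict s \<Lambda> \<in> configs \<Lambda>"
  by (auto simp: configs_def)

lemma pure_tensor_in_local_alg: "pure_tensor \<Lambda> a \<in> local_alg \<Lambda>"
  by (auto simp: pure_tensor_def local_alg_def)

lemma local_mult_pure_tensor:
  assumes "finite \<Lambda>"
  shows "local_mult \<Lambda> (pure_tensor \<Lambda> a) (pure_tensor \<Lambda> b) = pure_tensor \<Lambda> (\<lambda>e. a e ** b e)"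
proof (intro ext)
  fix s t
  show "local_mult \<Lambda> (pure_tensor \<Lambda> a) (pure_tensor \<Lambda> b) s t
          = pure_tensor \<Lambda> (\<lambda>e. a e ** b e) s t"
  proof (cases "s \<in> configs \<Lambda> \<and> t \<in> configs \<Lambda>")
    case True
    then have "local_mult \<Lambda> (pure_tensor \<Lambda> a) (pure_tensor \<Lambda> b) s t
        = (\<Sum>u\<in>configs \<Lambda>. \<Prod>e\<in>\<Lambda>. a e $ s e $ u e * b e $ u e $ t e)"
      by (auto simp: local_mult_def pure_tensor_def prod.distrib intro!: sum.cong)
    also have "\<dots> = (\<Prod>e\<in>\<Lambda>. \<Sum>k\<in>UNIV. a e $ s e $ k * b e $ k $ t e)"
      using assms by (simp add: configs_def prod_sum_PiE)
    finally show ?thesis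
      using True by (simp add: pure_tensor_def matrix_matrix_mult_def)
  next
    case False
    then show ?thesis
      by (auto simp: local_mult_def pure_tensor_def)
  qed
qed

lemma inclusion_pure_tensor:
  assumes "finite \<Lambda>" "\<Lambda>' \<subseteq> \<Lambda>"
  shows "inclusion \<Lambda>' \<Lambda> (pure_tensor \<Lambda>' a)
           = pure_tensor \<Lambda> (\<lambda>e. if e \<in> \<Lambda>' then a e else mat 1)"
proof (intro ext)
  fix s t
  let ?b = "\<lambda>e. if e \<in> \<Lambda>' then a e else mat 1"
  have "(\<Prod>e\<in>\<Lambda>. ?b e $ s e $ t e)
      = (\<Prod>e\<in>\<Lambda> - \<Lambda>'. ?b e $ s e $ t e) * (\<Prod>e\<in>\<Lambda>'. ?b e $ s e $ t e)"
    using assms by (intro prod.subset_diff) auto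
  also have "\<dots> = (\<Prod>e\<in>\<Lambda> - \<Lambda>'. mat 1 $ s e $ t e) * (\<Prod>e\<in>\<Lambda>'. a e $ s e $ t e)"
    by (intro arg_cong2[where f = "(*)"] prod.cong) auto
  finally show "inclusion \<Lambda>' \<Lambda> (pure_tensor \<Lambda>' a) s t = pure_tensor \<Lambda> ?b s t"
    by (simp add: inclusion_def local_one_def pure_tensor_def restrict_in_configs mult.commute)
qed


section \<open>The quasi-local algebra and the toric code operators\<close>

text \<open>\<open>\<iota>\<close> exhibits the $C^*$-algebra \<open>'a\<close> as the completion of the union of the local algebras:
  \<open>\<iota> \<Lambda>\<close> embeds $\mathcal A_\Lambda$ as a unital $*$-algebra, the embeddings respect the natural
  inclusions, and the union of their images is dense. This determines \<open>'a\<close> and \<open>\<iota>\<close> up to unique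
  isomorphism. Injective $*$-homomorphisms from the matrix algebras $\mathcal A_\Lambda$ are
  automatically isometric, so no condition on norms is needed.\<close>

locale quasi_local_algebra =
  fixes \<iota> :: "edge set \<Rightarrow> local_op \<Rightarrow> 'a::cstar_algebra"
  assumes iota_inj: "finite \<Lambda> \<Longrightarrow> \<Lambda> \<subseteq> lattice_edges \<Longrightarrow> inj_on (\<iota> \<Lambda>) (local_alg \<Lambda>)"
    and iota_add: "finite \<Lambda> \<Longrightarrow> \<Lambda> \<subseteq> lattice_edges \<Longrightarrow> m \<in> local_alg \<Lambda> \<Longrightarrow> n \<in> local_alg \<Lambda> \<Longrightarrow>
           \<iota> \<Lambda> (local_add m n) = \<iota> \<Lambda> m + \<iota> \<Lambda> n"
    and iota_scale: "finite \<Lambda> \<Longrightarrow> \<Lambda> \<subseteq> lattice_edges \<Longrightarrow> m \<in> local_alg \<Lambda> \<Longrightarrow>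
           \<iota> \<Lambda> (local_scale c m) = c *\<^sub>C \<iota> \<Lambda> m"
    and iota_mult: "finite \<Lambda> \<Longrightarrow> \<Lambda> \<subseteq> lattice_edges \<Longrightarrow> m \<in> local_alg \<Lambda> \<Longrightarrow> n \<in> local_alg \<Lambda> \<Longrightarrow>
           \<iota> \<Lambda> (local_mult \<Lambda> m n) = \<iota> \<Lambda> m * \<iota> \<Lambda> n"
    and iota_adj: "finite \<Lambda> \<Longrightarrow> \<Lambda> \<subseteq> lattice_edges \<Longrightarrow> m \<in> local_alg \<Lambda> \<Longrightarrow>
           \<iota> \<Lambda> (local_adj m) = adj (\<iota> \<Lambda> m)"
    and iota_one: "finite \<Lambda> \<Longrightarrow> \<Lambda> \<subseteq> lattice_edges \<Longrightarrow> \<iota> \<Lambda> (local_one \<Lambda>) = 1"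
    and iota_inclusion: "finite \<Lambda> \<Longrightarrow> \<Lambda> \<subseteq> lattice_edges \<Longrightarrow> \<Lambda>' \<subseteq> \<Lambda> \<Longrightarrow> m \<in> local_alg \<Lambda>' \<Longrightarrow>
           \<iota> \<Lambda> (inclusion \<Lambda>' \<Lambda> m) = \<iota> \<Lambda>' m"
    and iota_dense: "closure (\<Union>\<Lambda>\<in>{\<Lambda>. finite \<Lambda> \<and> \<Lambda> \<subseteq> lattice_edges}. \<iota> \<Lambda> ` local_alg \<Lambda>) = UNIV"

definition pauli_x :: "complex^2^2" where
  "pauli_x = vector [vector [0, 1], vector [1, 0]]"

definition pauli_z :: "complex^2^2" where
  "pauli_z = vector [vector [1, 0], vector [0, -1]]"

definition sigma_x :: "(edge set \<Rightarrow> local_op \<Rightarrow> 'a::cstar_algebra) \<Rightarrow> edge \<Rightarrow> 'a" where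
  "sigma_x \<iota> e = \<iota> {e} (pure_tensor {e} (\<lambda>_. pauli_x))"

definition sigma_z :: "(edge set \<Rightarrow> local_op \<Rightarrow> 'a::cstar_algebra) \<Rightarrow> edge \<Rightarrow> 'a" where
  "sigma_z \<iota> e = \<iota> {e} (pure_tensor {e} (\<lambda>_. pauli_z))"

text \<open>The product of a finite family of pairwise commuting elements of a monoid that need not be
  commutative, so that the library's \<open>prod\<close> does not apply.\<close>

definition commuting_prod :: "('i \<Rightarrow> 'a::monoid_mult) \<Rightarrow> 'i set \<Rightarrow> 'a" where
  "commuting_prod f S = Finite_Set.fold (\<lambda>i a. f i * a) 1 S"

definition star_op :: "(edge set \<Rightarrow> local_op \<Rightarrow> 'a::cstar_algebra) \<Rightarrow> vertex \<Rightarrow> 'a" where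
  "star_op \<iota> v = commuting_prod (sigma_x \<iota>) (star_edges v)"

definition face_op :: "(edge set \<Rightarrow> local_op \<Rightarrow> 'a::cstar_algebra) \<Rightarrow> face \<Rightarrow> 'a" where
  "face_op \<iota> f = commuting_prod (sigma_z \<iota>) (face_edges f)"

definition toric_diagonal :: "(edge set \<Rightarrow> local_op \<Rightarrow> 'a::cstar_algebra) \<Rightarrow> 'a set" where
  "toric_diagonal \<iota> = cstar_subalgebra hull (range (star_op \<iota>) \<union> range (face_op \<iota>))"

definition standard_diagonal :: "(edge set \<Rightarrow> local_op \<Rightarrow> 'a::cstar_algebra) \<Rightarrow> 'a set" where
  "standard_diagonal \<iota> = cstar_subalgebra hull (sigma_z \<iota> ` lattice_edges)"

end

theory Submission
  imports Defs
begin

text \<open>Order the vertices of the lattice along a spiral $v_0, v_1, \dots$ and the faces along the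
  image $u_0, u_1, \dots$ of the spiral under a rotation by 180 degrees. Every edge either joins
  some $v_n$ to $v_{n+1}$ or separates some $u_n$ from $u_{n+1}$, and not both; write $a_n$ and $b_n$
  for these edges. The partial products $A_{v_0} \cdots A_{v_n}$ and $B_{u_0} \cdots B_{u_n}$
  generate $\mathcal C$. The first equals $\sigma^x_{a_n}$ times a product of $\sigma^x_{b_j}$ over a
  finite set of $j$, and the second equals $\sigma^z_{b_n}$ times a product of $\sigma^z_{a_m}$.
  Since these products commute, the two families of finite sets are transposes of each other.
  Hence Hadamard gates at the $a_n$ followed by one controlled gate for each $n$ carry $\sigma^z$ to
  these products. All gates of one kind commute, and each generator of $\mathcal A$ is touched by
  finitely many of them, so the infinite product of the conjugations converges to an automorphism
  mapping $\mathcal D$ onto $\mathcal C$.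

  That the diagonal is a $C^*$-diagonal depends only on the Pauli relations, so it is proved for any
  generating Pauli system and then applied both to $\sigma^z$ and to its image.\<close>

section \<open>Elementary theory of $C^*$-algebras\<close>

text \<open>Only the conjugations are made to converge, not the product of the gates. The delicate
  generators are \<open>z\<close> at the edges b_j: a gate moves such a \<open>z\<close> when b_j is
  among its targets, and nothing local bounds the number of these gates. The transposition does:
  they are the gates whose control a_n occurs in the j-th face product, a finite set. The same count
  shows that the controls collected by \<open>z\<close> at b_j form exactly that product. The
  partial products isolate one path edge because a_m lies in precisely the stars of v_m and v_(m+1),
  so it enters at stage m and cancels at every later one. For the diagonals, the positivity facts
  about states come from a binomial series for the square root, and the expectation onto the
  diagonal is a limit of averages over conjugations by \<open>z\<close>.\<close>

lemma scaleC_of_real: "complex_of_real r *\<^sub>C x = r *\<^sub>R (x::'a::cstar_algebra)"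
  by (simp add: scaleR_scaleC)

lemma scaleC_one [simp]: "1 *\<^sub>C x = (x::'a::cstar_algebra)"
  using scaleC_of_real[of 1 x] by simp

lemma scaleC_zero [simp]: "0 *\<^sub>C x = (0::'a::cstar_algebra)"
  using scaleC_of_real[of 0 x] by simp

lemma scaleC_zero_right [simp]: "c *\<^sub>C 0 = (0::'a::cstar_algebra)"
  using norm_scaleC[of c "0::'a"] by simp

lemma scaleC_minus_one [simp]: "(-1) *\<^sub>C x = - (x::'a::cstar_algebra)"
  using scaleC_of_real[of "-1" x] by simp

lemma bounded_linear_scaleC: "bounded_linear (\<lambda>x. c *\<^sub>C (x::'a::cstar_algebra))"
  by (rule bounded_linear_intro[where K = "cmod c"])
    (simp_all add: scaleC_add_right norm_scaleC mult.commute scaleR_scaleC scaleC_scaleC)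

lemma adj_zero [simp]: "adj 0 = (0::'a::cstar_algebra)"
  using adj_add[of 0 "0::'a"] by simp

lemma adj_minus [simp]: "adj (- x) = - adj (x::'a::cstar_algebra)"
  by (metis add.right_inverse adj_add adj_zero minus_unique)

lemma adj_diff: "adj (x - y) = adj x - adj (y::'a::cstar_algebra)"
  by (simp only: diff_conv_add_uminus adj_add adj_minus)

lemma adj_one [simp]: "adj 1 = (1::'a::cstar_algebra)"
  by (metis adj_adj adj_mult mult.right_neutral)

lemma adj_scaleR [simp]: "adj (r *\<^sub>R x) = r *\<^sub>R adj (x::'a::cstar_algebra)"
  by (simp add: scaleR_scaleC adj_scaleC)

lemma norm_adj [simp]: "norm (adj x) = norm (x::'a::cstar_algebra)"
proof -
  have le: "norm y \<le> norm (adj y)" for y :: 'a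
  proof (cases "y = 0")
    case False
    have "norm y * norm y \<le> norm (adj y) * norm y"
      using cstar_identity[of y] norm_mult_ineq[of "adj y" y] by (simp add: power2_eq_square)
    with False show ?thesis by simp
  qed simp
  from le[of x] le[of "adj x"] show ?thesis by (simp add: adj_adj)
qed

lemma bounded_linear_adj: "bounded_linear (adj :: 'a::cstar_algebra \<Rightarrow> 'a)"
  by (rule bounded_linear_intro[where K = 1]) (simp_all add: adj_add)

lemma adj_sum: "adj (\<Sum>i\<in>S. f i) = (\<Sum>i\<in>S. adj (f i :: 'a::cstar_algebra))"
  by (rule linear_sum[OF bounded_linear.linear[OF bounded_linear_adj]])

lemma norm_unitary:
  assumes "adj u * u = (1::'a::cstar_algebra)"
  shows "norm u = 1"
  using cstar_identity[of u] assms norm_ge_zero[of u] by (simp add: power2_eq_1_iff)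

lemma norm_conj_unitary:
  fixes u :: "'a::cstar_algebra"
  assumes "adj u = u" "u * u = 1"
  shows "norm (u * x * u) = norm x"
proof -
  have u: "norm u = 1" using norm_unitary assms by metis
  have le: "norm (u * y * u) \<le> norm y" for y
    using norm_mult_ineq[of "u * y" u] norm_mult_ineq[of u y] u by simp
  have "u * (u * x * u) * u = (u * u) * x * (u * u)" by (simp only: mult.assoc)
  then have "u * (u * x * u) * u = x" using assms(2) by simp
  with le[of x] le[of "u * x * u"] show ?thesis by simp
qed

lemma cstar_subalgebra_hull: "cstar_subalgebra (cstar_subalgebra hull G)"
  by (rule hull_in) (auto simp: cstar_subalgebra_def intro!: closed_Inter)

lemma cstar_subalgebra_hull_minimal:
  "G \<subseteq> B \<Longrightarrow> cstar_subalgebra B \<Longrightarrow> cstar_subalgebra hull G \<subseteq> B"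
  by (rule hull_minimal)

context
  fixes B :: "'a::cstar_algebra set"
  assumes B: "cstar_subalgebra B"
begin

lemma subalgebra_zero: "0 \<in> B"
  and subalgebra_closed: "closed B"
  and subalgebra_add: "x \<in> B \<Longrightarrow> y \<in> B \<Longrightarrow> x + y \<in> B"
  and subalgebra_mult: "x \<in> B \<Longrightarrow> y \<in> B \<Longrightarrow> x * y \<in> B"
  and subalgebra_scaleC: "x \<in> B \<Longrightarrow> c *\<^sub>C x \<in> B"
  and subalgebra_adj: "x \<in> B \<Longrightarrow> adj x \<in> B"
  using B by (auto simp: cstar_subalgebra_def)

lemma subalgebra_minus: "x \<in> B \<Longrightarrow> - x \<in> B"
  using subalgebra_scaleC[of x "-1"] by simp

lemma subalgebra_diff: "x \<in> B \<Longrightarrow> y \<in> B \<Longrightarrow> x - y \<in> B"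
  using subalgebra_add[OF _ subalgebra_minus] by simp

lemma subalgebra_scaleR: "x \<in> B \<Longrightarrow> r *\<^sub>R x \<in> B"
  by (simp add: scaleR_scaleC subalgebra_scaleC)

lemma subalgebra_sum: "(\<And>i. i \<in> S \<Longrightarrow> f i \<in> B) \<Longrightarrow> (\<Sum>i\<in>S. f i) \<in> B"
  by (induction S rule: infinite_finite_induct) (auto intro: subalgebra_zero subalgebra_add)

lemma subalgebra_power: "1 \<in> B \<Longrightarrow> x \<in> B \<Longrightarrow> x ^ n \<in> B"
  by (induction n) (auto intro: subalgebra_mult)

end

lemma cstar_subalgebra_commutant:
  assumes "\<And>g. g \<in> G \<Longrightarrow> adj g \<in> G"
  shows "cstar_subalgebra {a::'a::cstar_algebra. \<forall>g\<in>G. a * g = g * a}" (is "cstar_subalgebra ?C")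
  unfolding cstar_subalgebra_def
proof (intro conjI ballI allI)
  have "?C = (\<Inter>g\<in>G. {a. a * g = g * a})" by auto
  also have "closed \<dots>"
    by (intro closed_INT ballI closed_Collect_eq continuous_intros)
  finally show "closed ?C" .
next
  fix x y assume xy: "x \<in> ?C" "y \<in> ?C"
  then show "x + y \<in> ?C" by (simp add: algebra_simps)
  have "x * y * g = g * (x * y)" if "g \<in> G" for g
    using xy that by (metis (mono_tags, lifting) mem_Collect_eq mult.assoc)
  then show "x * y \<in> ?C" by simp
next
  fix c x assume "x \<in> ?C"
  then show "c *\<^sub>C x \<in> ?C" by (simp add: mult_scaleC_left mult_scaleC_right)
next
  fix x assume x: "x \<in> ?C"
  have "adj x * g = g * adj x" if "g \<in> G" for g
  proof -
    have "adj (x * adj g) = adj (adj g * x)" using x assms[OF that] by simp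
    then show ?thesis by (simp add: adj_mult adj_adj)
  qed
  then show "adj x \<in> ?C" by simp
qed simp

text \<open>A double commutant argument: the commutant of \<open>G\<close> is a subalgebra
  containing \<open>G\<close>, hence the hull; so the commutant of the hull contains
  \<open>G\<close>, and again the hull.\<close>

lemma hull_commutative:
  fixes G :: "'a::cstar_algebra set"
  assumes adj: "\<And>g. g \<in> G \<Longrightarrow> adj g \<in> G"
    and comm: "\<And>g h. g \<in> G \<Longrightarrow> h \<in> G \<Longrightarrow> g * h = h * g"
    and "x \<in> cstar_subalgebra hull G" "y \<in> cstar_subalgebra hull G"
  shows "x * y = y * x"
proof -
  let ?H = "cstar_subalgebra hull G"
  have 1: "?H \<subseteq> {a. \<forall>g\<in>G. a * g = g * a}"
    by (rule cstar_subalgebra_hull_minimal) (auto intro: cstar_subalgebra_commutant adj comm)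
  have "cstar_subalgebra {a. \<forall>g\<in>?H. a * g = g * a}"
    by (intro cstar_subalgebra_commutant subalgebra_adj cstar_subalgebra_hull)
  moreover have "G \<subseteq> {a. \<forall>g\<in>?H. a * g = g * a}" using 1 by auto
  ultimately have "?H \<subseteq> {a. \<forall>g\<in>?H. a * g = g * a}"
    by (intro cstar_subalgebra_hull_minimal)
  with assms show ?thesis by auto
qed

section \<open>States are contractive\<close>

text \<open>Convergence of the binomial series at some s beyond the modulus of r forces absolute
  convergence at r.\<close>

lemma summable_sqrt_series:
  assumes "\<bar>r\<bar> < (1::real)"
  shows "summable (\<lambda>n. norm (((1/2) gchoose n) * r ^ n))"
proof -
  obtain s where s: "\<bar>r\<bar> < s" "s < 1" using assms dense by blast
  have "summable (\<lambda>n. ((1/2) gchoose n) * s ^ n)"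
    using gen_binomial_real[of s "1/2"] s by (auto simp: sums_iff)
  then show ?thesis by (rule powser_insidea) (use s in auto)
qed

text \<open>The binomial series of exponent 1/2 in \<open>- h\<close> converges absolutely, stays in
  the closed set \<open>B\<close>, and squares to 1 - h by the Cauchy product. It replaces
  functional calculus as the source of positivity.\<close>

lemma exists_sqrt_one_minus:
  fixes h :: "'a::cstar_algebra"
  assumes B: "cstar_subalgebra B" "1 \<in> B" and h: "h \<in> B" "adj h = h" "norm h < 1"
  shows "\<exists>b\<in>B. adj b = b \<and> b * b = 1 - h"
proof -
  define c where "c n = (1/2 :: real) gchoose n" for n
  define f where "f n = c n *\<^sub>R (- h) ^ n" for n
  have sum_norm: "summable (\<lambda>n. norm (f n))"
  proof (rule summable_comparison_test')
    show "summable (\<lambda>n. norm (c n * norm h ^ n))"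
      using summable_sqrt_series[of "norm h"] h unfolding c_def by simp
    show "norm (norm (f n)) \<le> norm (c n * norm h ^ n)" for n
      using norm_power_ineq[of "- h" n] unfolding f_def
      by (simp add: abs_mult mult_left_mono)
  qed
  then have sums: "f sums suminf f"
    using summable_norm_cancel summable_sums by blast
  have fB: "f n \<in> B" for n
    unfolding f_def by (intro subalgebra_scaleR subalgebra_power subalgebra_minus B h)
  have bB: "suminf f \<in> B"
  proof (rule closed_sequentially[OF subalgebra_closed[OF B(1)]])
    show "(\<lambda>n. \<Sum>i<n. f i) \<longlonglongrightarrow> suminf f" using sums by (simp add: sums_def)
    show "(\<Sum>i<n. f i) \<in> B" for n by (intro subalgebra_sum B fB)
  qed
  have adj_pow: "adj ((- h) ^ n) = (- h) ^ n" for n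
  proof (induction n)
    case (Suc n)
    then show ?case by (simp only: power_Suc adj_mult adj_minus h(2) power_commutes)
  qed simp
  have "(\<lambda>n. adj (f n)) sums adj (suminf f)"
    by (rule bounded_linear.sums[OF bounded_linear_adj sums])
  moreover have "(\<lambda>n. adj (f n)) = f" by (simp add: f_def adj_pow fun_eq_iff)
  ultimately have adj_b: "adj (suminf f) = suminf f"
    using sums sums_unique2 by metis
  have conv: "(\<Sum>i\<le>k. f i * f (k - i)) = (1 gchoose k) *\<^sub>R (- h) ^ k" for k
  proof -
    have "(\<Sum>i\<le>k. f i * f (k - i)) = (\<Sum>i\<le>k. (c i * c (k - i)) *\<^sub>R (- h) ^ k)"
    proof (rule sum.cong)
      fix i assume "i \<in> {..k}"
      then have "(- h) ^ i * (- h) ^ (k - i) = (- h) ^ k"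
        by (simp flip: power_add)
      then show "f i * f (k - i) = (c i * c (k - i)) *\<^sub>R (- h) ^ k"
        by (simp add: f_def)
    qed simp
    also have "\<dots> = (\<Sum>i\<le>k. c i * c (k - i)) *\<^sub>R (- h) ^ k"
      by (rule scaleR_left.sum[symmetric])
    \<comment> \<open>Vandermonde with 1/2 + 1/2 = 1: the squared series is that of exponent 1,
      which stops after two terms.\<close>
    also have "(\<Sum>i\<le>k. c i * c (k - i)) = 1 gchoose k"
      using gbinomial_Vandermonde[of "1/2" "1/2::real" k] by (simp add: c_def atMost_atLeast0)
    finally show ?thesis .
  qed
  have "(\<lambda>k. \<Sum>i\<le>k. f i * f (k - i)) sums (suminf f * suminf f)"
    by (rule Cauchy_product_sums[OF sum_norm sum_norm])
  moreover have "(\<lambda>k. (1 gchoose k) *\<^sub>R (- h) ^ k) sums (1 - h)"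
  proof -
    have z: "(1::real) gchoose k = 0" if "k \<notin> {..<2}" for k
      using that binomial_gbinomial[of 1 k, where 'a = real] by (simp add: binomial_eq_0)
    have "(\<lambda>k. ((1::real) gchoose k) *\<^sub>R (- h) ^ k) sums (\<Sum>k<2. ((1::real) gchoose k) *\<^sub>R (- h) ^ k)"
      by (rule sums_finite) (simp_all add: z)
    then show ?thesis by (simp add: numeral_2_eq_2)
  qed
  ultimately have "suminf f * suminf f = 1 - h"
    unfolding conv using sums_unique2 by blast
  with bB adj_b show ?thesis by blast
qed

text \<open>\<open>B\<close> is kept general because the estimates are applied both to the diagonal
  and to the whole algebra. \<open>state_on\<close> contains no continuity; it is derived
  below.\<close>

locale cstar_state =
  fixes B :: "'a::cstar_algebra set" and \<phi> :: "'a \<Rightarrow> complex"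
  assumes subalg: "cstar_subalgebra B" and one_in: "1 \<in> B" and state: "state_on B \<phi>"
begin

lemma add: "x \<in> B \<Longrightarrow> y \<in> B \<Longrightarrow> \<phi> (x + y) = \<phi> x + \<phi> y"
  and scale: "x \<in> B \<Longrightarrow> \<phi> (c *\<^sub>C x) = c * \<phi> x"
  and pos: "x \<in> B \<Longrightarrow> \<phi> (adj x * x) \<in> \<real>\<^sub>\<ge>\<^sub>0"
  and one: "\<phi> 1 = 1"
  using state by (auto simp: state_on_def)

lemmas closed_ops = subalgebra_add[OF subalg] subalgebra_mult[OF subalg]
  subalgebra_scaleC[OF subalg] subalgebra_scaleR[OF subalg] subalgebra_adj[OF subalg]
  subalgebra_minus[OF subalg] subalgebra_diff[OF subalg] subalgebra_zero[OF subalg] one_in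

lemma minus: "x \<in> B \<Longrightarrow> \<phi> (- x) = - \<phi> x"
  using scale[of x "-1"] by simp

lemma diff: "x \<in> B \<Longrightarrow> y \<in> B \<Longrightarrow> \<phi> (x - y) = \<phi> x - \<phi> y"
  using add[of x "- y"] minus[of y] closed_ops by simp

lemma zero: "\<phi> 0 = 0"
  using scale[of 0 0] closed_ops by simp

lemma expand:
  assumes "x \<in> B" "y \<in> B"
  shows "\<phi> (adj (x + c *\<^sub>C y) * (x + c *\<^sub>C y))
    = \<phi> (adj x * x) + c * \<phi> (adj x * y) + cnj c * \<phi> (adj y * x) + (c * cnj c) * \<phi> (adj y * y)"
proof -
  have "adj (x + c *\<^sub>C y) * (x + c *\<^sub>C y)
    = adj x * x + c *\<^sub>C (adj x * y) + cnj c *\<^sub>C (adj y * x) + (c * cnj c) *\<^sub>C (adj y * y)"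
    by (simp add: adj_add adj_scaleC algebra_simps mult_scaleC_left mult_scaleC_right scaleC_scaleC scaleC_add_right)
  with assms show ?thesis by (simp add: add scale closed_ops)
qed

text \<open>Expanding positivity at 1 + c x for c = 1 and c = \<i> fixes the imaginary and the real
  part of \<phi> (adj x) respectively.\<close>

lemma hermitian:
  assumes x: "x \<in> B"
  shows "\<phi> (adj x) = cnj (\<phi> x)"
proof -
  have im: "Im (\<phi> (adj y * y)) = 0" if "y \<in> B" for y
    using pos[OF that] by (auto simp: complex_nonneg_Reals_iff)
  have B: "1 + c *\<^sub>C x \<in> B" for c using x by (intro closed_ops)
  from im[OF B[of 1], unfolded expand[OF one_in x]] im[OF B[of \<i>], unfolded expand[OF one_in x]]
  show ?thesis
    using im[OF one_in] im[OF x] by (simp add: complex_eq_iff)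
qed

text \<open>For y of norm below 1, the element 1 - y^* y is a square, so \<phi> is at most 1 on y^*
  y; nonnegative variance then bounds \<phi> y. Scaling x by any r above its norm reduces to this
  case.\<close>

lemma cmod_le:
  assumes x: "x \<in> B"
  shows "cmod (\<phi> x) \<le> norm x"
proof (rule dense_ge)
  fix r assume r: "norm x < r"
  then have r0: "r > 0" using norm_ge_zero[of x] by linarith
  define y where "y = (1 / r) *\<^sub>R x"
  have yB: "y \<in> B" unfolding y_def by (intro closed_ops x)
  have ny: "norm y < 1" using r r0 by (simp add: y_def)
  have "norm (adj y * y) < 1"
    using ny by (simp add: cstar_identity power_less_one_iff abs_square_less_1)
  moreover have "adj (adj y * y) = adj y * y" by (simp add: adj_mult adj_adj)
  moreover have "adj y * y \<in> B" by (intro closed_ops yB)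
  ultimately obtain b where b: "b \<in> B" "adj b = b" "b * b = 1 - adj y * y"
    using exists_sqrt_one_minus[OF subalg one_in, of "adj y * y"] by metis
  have "\<phi> (1 - adj y * y) \<in> \<real>\<^sub>\<ge>\<^sub>0" using pos[OF b(1)] b by simp
  then have le1: "Re (\<phi> (adj y * y)) \<le> 1"
    using yB by (auto simp: diff one closed_ops complex_nonneg_Reals_iff)
  have "\<phi> (adj (y + (- \<phi> y) *\<^sub>C 1) * (y + (- \<phi> y) *\<^sub>C 1)) \<in> \<real>\<^sub>\<ge>\<^sub>0"
    by (intro pos closed_ops yB)
  then have "\<phi> (adj y * y) - \<phi> y * cnj (\<phi> y) \<in> \<real>\<^sub>\<ge>\<^sub>0"
    unfolding expand[OF yB one_in] using yB by (simp add: hermitian one mult.commute)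
  then have "Re (\<phi> y * cnj (\<phi> y)) \<le> Re (\<phi> (adj y * y))"
    by (simp add: complex_nonneg_Reals_iff)
  with le1 have "(cmod (\<phi> y))\<^sup>2 \<le> 1"
    by (simp add: complex_mult_cnj cmod_power2)
  then have "cmod (\<phi> y) \<le> 1" by (simp add: power_le_one_iff abs_square_le_1)
  moreover have "\<phi> x = r * \<phi> y"
    using scale[OF yB, of "of_real r"] r0 by (simp add: scaleC_of_real y_def)
  ultimately show "cmod (\<phi> x) \<le> r"
    using r0 by (simp add: norm_mult)
qed

lemma cmod_diff_le: "x \<in> B \<Longrightarrow> y \<in> B \<Longrightarrow> cmod (\<phi> x - \<phi> y) \<le> norm (x - y)"
  using cmod_le[of "x - y"] by (simp add: diff closed_ops)

text \<open>The degenerate case of Cauchy-Schwarz: if the quadratic term vanishes, a nonzero linear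
  term would make the form negative somewhere.\<close>

lemma null_mult:
  assumes x: "x \<in> B" and y: "y \<in> B" and null: "\<phi> (adj x * x) = 0"
  shows "\<phi> (adj x * y) = 0" "\<phi> (adj y * x) = 0"
proof -
  define k where "k = \<phi> (adj x * y)"
  have cnj_k: "\<phi> (adj y * x) = cnj k"
    using hermitian[of "adj x * y"] x y by (simp add: k_def adj_mult adj_adj closed_ops)
  show "\<phi> (adj x * y) = 0"
  proof (rule ccontr)
    assume "\<phi> (adj x * y) \<noteq> 0"
    then have k: "cmod k > 0" by (simp add: k_def)
    define s where "s = Re (\<phi> (adj y * y))"
    have yy: "\<phi> (adj y * y) = of_real s"
      using pos[OF y] by (auto simp: s_def complex_nonneg_Reals_iff complex_eq_iff)
    \<comment> \<open>Chosen so that the form takes the value s - 2 (\<bar>s\<bar> + 1), which is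
      negative whatever the sign of s.\<close>
    define t where "t = - (\<bar>s\<bar> + 1) / (cmod k)\<^sup>2"
    have "\<phi> (adj (y + (of_real t * k) *\<^sub>C x) * (y + (of_real t * k) *\<^sub>C x)) \<in> \<real>\<^sub>\<ge>\<^sub>0"
      by (intro pos closed_ops x y)
    then have "of_real s + 2 * of_real t * (k * cnj k) \<in> \<real>\<^sub>\<ge>\<^sub>0"
      by (simp add: expand[OF y x] null cnj_k flip: k_def yy) (simp add: algebra_simps yy)
    then have "0 \<le> s + 2 * t * (cmod k)\<^sup>2"
      by (simp add: complex_nonneg_Reals_iff complex_mult_cnj cmod_power2 flip: of_real_power of_real_add)
    also have "t * (cmod k)\<^sup>2 = - (\<bar>s\<bar> + 1)" using k by (simp add: t_def)
    then have "s + 2 * t * (cmod k)\<^sup>2 = s - 2 * (\<bar>s\<bar> + 1)" by simp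
    finally show False using abs_ge_self[of s] abs_ge_zero[of s] by argo
  qed
  with cnj_k k_def show "\<phi> (adj y * x) = 0" by simp
qed

end

section \<open>Isometric automorphisms\<close>

text \<open>Isometry is carried along to have continuity at hand: it makes preimages of closed
  subalgebras closed.\<close>

definition isometric_automorphism :: "('a::cstar_algebra \<Rightarrow> 'a) \<Rightarrow> bool" where
  "isometric_automorphism \<alpha> \<longleftrightarrow> star_iso UNIV UNIV \<alpha> \<and> (\<forall>x. norm (\<alpha> x) = norm x)"

context
  fixes \<alpha> :: "'a::cstar_algebra \<Rightarrow> 'a"
  assumes \<alpha>: "isometric_automorphism \<alpha>"
begin

lemma aut_bij: "bij \<alpha>"
  and aut_add: "\<alpha> (x + y) = \<alpha> x + \<alpha> y"
  and aut_mult: "\<alpha> (x * y) = \<alpha> x * \<alpha> y"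
  and aut_scaleC: "\<alpha> (c *\<^sub>C x) = c *\<^sub>C \<alpha> x"
  and aut_adj: "\<alpha> (adj x) = adj (\<alpha> x)"
  and aut_norm: "norm (\<alpha> x) = norm x"
  using \<alpha> by (auto simp: isometric_automorphism_def star_iso_def)

lemma aut_minus: "\<alpha> (- x) = - \<alpha> x"
  using aut_scaleC[of "-1" x] by simp

lemma aut_one: "\<alpha> 1 = 1"
proof -
  obtain y where "\<alpha> y = 1" using aut_bij by (metis bij_pointE)
  then show ?thesis using aut_mult[of 1 y] by simp
qed

lemma bounded_linear_aut: "bounded_linear \<alpha>"
  by (rule bounded_linear_intro[where K = 1]) (simp_all add: aut_add aut_norm scaleR_scaleC aut_scaleC)

lemma isometric_automorphism_inv: "isometric_automorphism (inv \<alpha>)"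
proof -
  have s: "\<alpha> (inv \<alpha> x) = x" for x using aut_bij by (simp add: bij_is_surj surj_f_inv_f)
  have i: "inv \<alpha> (\<alpha> x) = x" for x using aut_bij by (simp add: bij_is_inj)
  have n: "norm (inv \<alpha> x) = norm x" for x using aut_norm[of "inv \<alpha> x"] by (simp add: s)
  have "inv \<alpha> (x + y) = inv \<alpha> x + inv \<alpha> y" "inv \<alpha> (x * y) = inv \<alpha> x * inv \<alpha> y"
    "inv \<alpha> (c *\<^sub>C x) = c *\<^sub>C inv \<alpha> x" "inv \<alpha> (adj x) = adj (inv \<alpha> x)" for x y c
    by (metis s i aut_add aut_mult aut_scaleC aut_adj)+
  with n show ?thesis
    using aut_bij by (simp add: isometric_automorphism_def star_iso_def bij_imp_bij_inv)
qed

lemma cstar_subalgebra_vimage: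
  assumes "cstar_subalgebra B"
  shows "cstar_subalgebra (\<alpha> -` B)"
proof -
  have "\<alpha> 0 = 0" using aut_norm[of 0] by simp
  moreover have "closed (\<alpha> -` B)"
    using bounded_linear_aut subalgebra_closed[OF assms]
    by (intro closed_vimage) (auto intro: linear_continuous_on)
  ultimately show ?thesis
    using assms by (simp add: cstar_subalgebra_def aut_add aut_mult aut_scaleC aut_adj)
qed

end

text \<open>The nontrivial inclusion needs the image of the hull to be a closed subalgebra; it is
  one as a preimage under the inverse automorphism.\<close>

lemma aut_image_hull:
  fixes \<alpha> :: "'a::cstar_algebra \<Rightarrow> 'a"
  assumes \<alpha>: "isometric_automorphism \<alpha>"
  shows "\<alpha> ` (cstar_subalgebra hull G) = cstar_subalgebra hull (\<alpha> ` G)"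
proof
  have "cstar_subalgebra hull G \<subseteq> \<alpha> -` (cstar_subalgebra hull (\<alpha> ` G))"
    by (intro cstar_subalgebra_hull_minimal cstar_subalgebra_vimage \<alpha> cstar_subalgebra_hull)
      (auto intro: hull_inc)
  then show "\<alpha> ` (cstar_subalgebra hull G) \<subseteq> cstar_subalgebra hull (\<alpha> ` G)" by auto
  have "\<alpha> ` (cstar_subalgebra hull G) = inv \<alpha> -` (cstar_subalgebra hull G)"
    by (rule bij_image_Collect_eq[OF aut_bij[OF \<alpha>], of "\<lambda>x. x \<in> cstar_subalgebra hull G",
      simplified, folded vimage_def])
  also have "cstar_subalgebra \<dots>"
    by (intro cstar_subalgebra_vimage isometric_automorphism_inv \<alpha> cstar_subalgebra_hull)
  finally show "cstar_subalgebra hull (\<alpha> ` G) \<subseteq> \<alpha> ` (cstar_subalgebra hull G)"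
    by (intro cstar_subalgebra_hull_minimal) (auto intro: hull_inc)
qed

lemma isometric_automorphism_comp:
  assumes "isometric_automorphism \<alpha>" "isometric_automorphism \<beta>"
  shows "isometric_automorphism (\<alpha> \<circ> \<beta>)"
  using assms by (auto simp: isometric_automorphism_def star_iso_def intro: bij_comp)

section \<open>Infinite products of commuting gates\<close>

primrec gate_prod :: "(nat \<Rightarrow> 'a::monoid_mult) \<Rightarrow> nat \<Rightarrow> 'a" where
  "gate_prod w 0 = 1"
| "gate_prod w (Suc n) = w n * gate_prod w n"

text \<open>The gates are commuting self-adjoint unitaries. By \<open>finite_support\<close> the
  conjugates of a generator become stationary, and isometry carries convergence over to the norm
  closure.\<close>

locale gates =
  fixes w :: "nat \<Rightarrow> 'a::cstar_algebra" and G :: "'a set"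
  assumes w_adj: "adj (w k) = w k" and w_sq: "w k * w k = 1" and w_comm: "w k * w l = w l * w k"
    and gen: "cstar_subalgebra hull G = UNIV"
    and finite_support: "g \<in> G \<Longrightarrow> finite {k. w k * g \<noteq> g * w k}"
begin

abbreviation U where "U \<equiv> gate_prod w"

lemma w_U: "w k * U n = U n * w k"
  by (induction n) (simp_all, metis mult.assoc w_comm)

lemma U_adj: "adj (U n) = U n"
  by (induction n) (simp_all add: adj_mult w_adj w_U)

lemma U_sq: "U n * U n = 1"
proof (induction n)
  case (Suc n)
  have "U (Suc n) * U (Suc n) = w n * (U n * w n) * U n"
    by (simp add: mult.assoc)
  also have "\<dots> = (w n * w n) * (U n * U n)"
    by (simp add: mult.assoc flip: w_U)
  finally show ?case by (simp add: w_sq Suc)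
qed simp

lemma norm_conj: "norm (U n * x * U n) = norm x"
  by (rule norm_conj_unitary[OF U_adj U_sq])

lemma conj_mult: "U n * (x * y) * U n = (U n * x * U n) * (U n * y * U n)"
proof -
  have "(U n * x * U n) * (U n * y * U n) = U n * x * (U n * U n) * y * U n"
    by (simp only: mult.assoc)
  then show ?thesis by (simp add: U_sq mult.assoc)
qed

lemma conj_conj: "U n * (U n * x * U n) * U n = x"
proof -
  have "U n * (U n * x * U n) * U n = (U n * U n) * x * (U n * U n)" by (simp only: mult.assoc)
  then show ?thesis by (simp add: U_sq)
qed

lemma conj_Suc: "U (Suc n) * x * U (Suc n) = w n * (U n * x * U n) * w n"
proof -
  have "U (Suc n) * x * U (Suc n) = (w n * U n) * x * (w n * U n)" by simp
  also have "\<dots> = (w n * U n) * x * (U n * w n)" by (simp only: w_U)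
  finally show ?thesis by (simp only: mult.assoc)
qed

text \<open>As the gates commute, the newest one may be applied innermost; this is the form in which
  a gate commuting with x drops out.\<close>

lemma conj_Suc': "U (Suc n) * x * U (Suc n) = U n * (w n * x * w n) * U n"
proof -
  have "U (Suc n) * x * U (Suc n) = (w n * U n) * x * (w n * U n)" by simp
  also have "\<dots> = (U n * w n) * x * (w n * U n)" by (simp only: w_U)
  finally show ?thesis by (simp only: mult.assoc)
qed

lemma conj_Suc_commuting:
  assumes "w n * x = x * w n"
  shows "U (Suc n) * x * U (Suc n) = U n * x * U n"
proof -
  have "w n * x * w n = x * (w n * w n)" by (simp add: assms mult.assoc)
  then show ?thesis unfolding conj_Suc' by (simp add: w_sq)
qed

text \<open>The elements with convergent conjugates form a closed star-subalgebra (closedness by an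
  e/3 argument with isometric conjugations) that contains the generators.\<close>

lemma conj_convergent: "convergent (\<lambda>n. U n * x * U n)"
proof -
  let ?C = "{x. convergent (\<lambda>n. U n * x * U n)}"
  have "cstar_subalgebra ?C"
    unfolding cstar_subalgebra_def
  proof (intro conjI ballI allI)
    show "0 \<in> ?C" by (simp add: convergent_const)
    show "closed ?C"
      unfolding closed_sequential_limits
    proof (intro allI impI, elim conjE)
      fix s l assume s: "\<forall>n. s n \<in> ?C" and l: "s \<longlonglongrightarrow> l"
      have "Cauchy (\<lambda>n. U n * l * U n)"
      proof (rule metric_CauchyI)
        fix e :: real assume e: "e > 0"
        obtain k where k: "dist (s k) l < e/3"
          using l e by (metis LIMSEQ_iff_nz dist_norm less_divide_eq_numeral1(1) mult_zero_left order_refl zero_less_divide_iff zero_less_numeral)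
        have "Cauchy (\<lambda>n. U n * s k * U n)" using s by (auto intro: convergent_Cauchy)
        then obtain M where M: "\<And>m n. m \<ge> M \<Longrightarrow> n \<ge> M \<Longrightarrow>
            dist (U m * s k * U m) (U n * s k * U n) < e/3"
          using e unfolding Cauchy_def by (metis divide_pos_pos zero_less_numeral)
        have d: "dist (U n * s k * U n) (U n * l * U n) < e/3" for n
          using k norm_conj[of n "s k - l"] by (simp add: dist_norm algebra_simps)
        show "\<exists>M. \<forall>m\<ge>M. \<forall>n\<ge>M. dist (U m * l * U m) (U n * l * U n) < e"
        proof (intro exI[of _ M] allI impI)
          fix m n assume "m \<ge> M" "n \<ge> M"
          have "dist (U m * l * U m) (U n * l * U n) \<le> dist (U m * l * U m) (U m * s k * U m)
              + (dist (U m * s k * U m) (U n * s k * U n) + dist (U n * s k * U n) (U n * l * U n))"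
            by (meson add_left_mono dist_triangle order_trans)
          then show "dist (U m * l * U m) (U n * l * U n) < e"
            using M[OF \<open>m \<ge> M\<close> \<open>n \<ge> M\<close>] d[of m] d[of n]
            by (simp only: dist_commute[of "U m * l * U m" "U m * s k * U m"])
        qed
      qed
      then show "l \<in> ?C" by (simp add: Cauchy_convergent_iff)
    qed
  next
    fix x y assume "x \<in> ?C" "y \<in> ?C"
    then show "x + y \<in> ?C" "x * y \<in> ?C"
      by (auto simp: conj_mult distrib_left distrib_right intro: convergent_add convergent_mult)
  next
    fix c x assume "x \<in> ?C"
    then have "convergent (\<lambda>n. c *\<^sub>C (U n * x * U n))"
      by (auto simp: convergent_def intro: bounded_linear.tendsto[OF bounded_linear_scaleC])
    then show "c *\<^sub>C x \<in> ?C" by (simp add: mult_scaleC_left mult_scaleC_right)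
  next
    fix x assume "x \<in> ?C"
    then have "convergent (\<lambda>n. adj (U n * x * U n))"
      by (auto simp: convergent_def intro: bounded_linear.tendsto[OF bounded_linear_adj])
    then show "adj x \<in> ?C" by (simp add: adj_mult U_adj mult.assoc)
  qed
  moreover have "g \<in> ?C" if g: "g \<in> G" for g
  proof -
    obtain N where N: "\<And>k. k \<ge> N \<Longrightarrow> w k * g = g * w k"
      using finite_support[OF g] finite_nat_set_iff_bounded
      by (metis (mono_tags, lifting) mem_Collect_eq linorder_not_less)
    have "U (N + n) * g * U (N + n) = U N * g * U N" for n
      by (induction n) (simp_all add: conj_Suc_commuting N del: gate_prod.simps)
    then have "convergent (\<lambda>n. U (n + N) * g * U (n + N))"
      by (simp add: add.commute convergent_const)
    then have "convergent (\<lambda>n. U n * g * U n)"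
      by (rule iffD1[OF convergent_ignore_initial_segment])
    then show ?thesis by simp
  qed
  ultimately have "cstar_subalgebra hull G \<subseteq> ?C"
    by (intro cstar_subalgebra_hull_minimal) auto
  then show ?thesis using gen by auto
qed

definition limit_aut :: "'a \<Rightarrow> 'a" where
  "limit_aut x = lim (\<lambda>n. U n * x * U n)"

lemma tendsto_limit_aut: "(\<lambda>n. U n * x * U n) \<longlonglongrightarrow> limit_aut x"
  unfolding limit_aut_def using conj_convergent convergent_LIMSEQ_iff by blast

lemma limit_aut_eqI:
  assumes "\<And>n. n \<ge> N \<Longrightarrow> U n * x * U n = y"
  shows "limit_aut x = y"
proof (rule LIMSEQ_unique[OF tendsto_limit_aut])
  show "(\<lambda>n. U n * x * U n) \<longlonglongrightarrow> y"
    by (rule tendsto_eventually) (use assms eventually_sequentially in blast)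
qed

text \<open>Each finite conjugation is an isometric involution, so the distance from U_n L(x) U_n to
  x equals the distance from L(x) to U_n x U_n, which tends to 0. Bijectivity of the limit
  follows.\<close>

lemma limit_aut_involution: "limit_aut (limit_aut x) = x"
proof (rule LIMSEQ_unique[OF tendsto_limit_aut])
  have "norm (U n * limit_aut x * U n - x) = norm (limit_aut x - U n * x * U n)" for n
  proof -
    have "U n * (limit_aut x - U n * x * U n) * U n = U n * limit_aut x * U n - x"
      using conj_conj[of n x] by (simp add: algebra_simps)
    then show ?thesis using norm_conj by metis
  qed
  moreover have "(\<lambda>n. norm (limit_aut x - U n * x * U n)) \<longlonglongrightarrow> norm (limit_aut x - limit_aut x)"
    by (intro tendsto_intros tendsto_limit_aut)
  ultimately show "(\<lambda>n. U n * limit_aut x * U n) \<longlonglongrightarrow> x"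
    by (simp add: tendsto_iff dist_norm)
qed

lemma isometric_automorphism_limit_aut: "isometric_automorphism limit_aut"
proof -
  have "limit_aut (x + y) = limit_aut x + limit_aut y" for x y
    using tendsto_add[OF tendsto_limit_aut[of x] tendsto_limit_aut[of y]]
      tendsto_limit_aut[of "x + y"] by (auto simp: distrib_left distrib_right intro: LIMSEQ_unique)
  moreover have "limit_aut (x * y) = limit_aut x * limit_aut y" for x y
    using tendsto_mult[OF tendsto_limit_aut[of x] tendsto_limit_aut[of y]]
      tendsto_limit_aut[of "x * y"] by (auto simp: conj_mult intro: LIMSEQ_unique)
  moreover have "limit_aut (c *\<^sub>C x) = c *\<^sub>C limit_aut x" for c x
    using bounded_linear.tendsto[OF bounded_linear_scaleC tendsto_limit_aut[of x], of c]
      tendsto_limit_aut[of "c *\<^sub>C x"]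
    by (auto simp: mult_scaleC_left mult_scaleC_right intro: LIMSEQ_unique)
  moreover have "limit_aut (adj x) = adj (limit_aut x)" for x
    using bounded_linear.tendsto[OF bounded_linear_adj tendsto_limit_aut[of x]]
      tendsto_limit_aut[of "adj x"]
    by (auto simp: adj_mult U_adj mult.assoc intro: LIMSEQ_unique)
  moreover have "norm (limit_aut x) = norm x" for x
    using tendsto_norm[OF tendsto_limit_aut[of x]]
    by (auto simp: norm_conj LIMSEQ_const_iff)
  moreover have "bij limit_aut"
    by (rule o_bij[where g = limit_aut]) (auto simp: limit_aut_involution)
  ultimately show ?thesis
    by (simp add: isometric_automorphism_def star_iso_def)
qed

end

section \<open>Products of commuting involutions\<close>

lemma isometric_automorphism_inner:
  fixes u :: "'a::cstar_algebra"
  assumes u: "adj u = u" "u * u = 1"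
  shows "isometric_automorphism (\<lambda>x. u * x * u)"
proof -
  have inv: "u * (u * x * u) * u = x" for x
  proof -
    have "u * (u * x * u) * u = (u * u) * x * (u * u)" by (simp only: mult.assoc)
    then show ?thesis by (simp add: u)
  qed
  have mult: "u * (x * y) * u = (u * x * u) * (u * y * u)" for x y
  proof -
    have "(u * x * u) * (u * y * u) = u * x * (u * u) * y * u" by (simp only: mult.assoc)
    then show ?thesis by (simp add: u mult.assoc)
  qed
  have "bij (\<lambda>x. u * x * u)"
    by (rule o_bij[where g = "\<lambda>x. u * x * u"]) (auto simp: inv)
  then show ?thesis
    by (simp add: isometric_automorphism_def star_iso_def mult norm_conj_unitary[OF u] distrib_left
        distrib_right mult_scaleC_left mult_scaleC_right adj_mult u(1))
      (simp add: mult.assoc)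
qed

lemma cstar_subalgebra_closure:
  fixes L :: "'a::cstar_algebra set"
  assumes zero: "0 \<in> L"
    and add: "\<And>x y. x \<in> L \<Longrightarrow> y \<in> L \<Longrightarrow> x + y \<in> L"
    and mult: "\<And>x y. x \<in> L \<Longrightarrow> y \<in> L \<Longrightarrow> x * y \<in> L"
    and scale: "\<And>c x. x \<in> L \<Longrightarrow> c *\<^sub>C x \<in> L"
    and adj: "\<And>x. x \<in> L \<Longrightarrow> adj x \<in> L"
  shows "cstar_subalgebra (closure L)"
  unfolding cstar_subalgebra_def
proof (intro conjI ballI allI)
  show "0 \<in> closure L" using zero closure_subset by blast
next
  fix x y assume "x \<in> closure L" "y \<in> closure L"
  then obtain s t where s: "\<And>n. s n \<in> L" "s \<longlonglongrightarrow> x" and t: "\<And>n. t n \<in> L" "t \<longlonglongrightarrow> y"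
    unfolding closure_sequential by metis
  show "x + y \<in> closure L"
    unfolding closure_sequential
    by (rule exI[of _ "\<lambda>n. s n + t n"]) (simp add: add s(1) t(1) tendsto_add[OF s(2) t(2)])
  show "x * y \<in> closure L"
    unfolding closure_sequential
    by (rule exI[of _ "\<lambda>n. s n * t n"]) (simp add: mult s(1) t(1) tendsto_mult[OF s(2) t(2)])
next
  fix c x assume "x \<in> closure L"
  then obtain s where s: "\<And>n. s n \<in> L" "s \<longlonglongrightarrow> x"
    unfolding closure_sequential by metis
  show "c *\<^sub>C x \<in> closure L"
    unfolding closure_sequential
    by (rule exI[of _ "\<lambda>n. c *\<^sub>C s n"])
      (simp add: scale s(1) bounded_linear.tendsto[OF bounded_linear_scaleC s(2)])
next
  fix x assume "x \<in> closure L"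
  then obtain s where s: "\<And>n. s n \<in> L" "s \<longlonglongrightarrow> x"
    unfolding closure_sequential by metis
  show "adj x \<in> closure L"
    unfolding closure_sequential
    by (rule exI[of _ "\<lambda>n. adj (s n)"])
      (simp add: adj s(1) bounded_linear.tendsto[OF bounded_linear_adj s(2)])
qed simp

lemma commuting_prod_empty [simp]: "commuting_prod f {} = 1"
  by (simp add: commuting_prod_def)

locale commuting_family =
  fixes f :: "'i \<Rightarrow> 'a::monoid_mult"
  assumes commute: "f i * f j = f j * f i"
begin

lemma comp_fun_commute_mult: "comp_fun_commute_on UNIV (\<lambda>i a. f i * a)"
proof
  have "f i * (f j * a) = f j * (f i * a)" for i j a
    using commute[of i j] by (simp flip: mult.assoc)
  then show "(\<lambda>a. f j * a) \<circ> (\<lambda>a. f i * a) = (\<lambda>a. f i * a) \<circ> (\<lambda>a. f j * a)" for i j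
    by (simp add: fun_eq_iff)
qed

lemma prod_insert:
  "finite S \<Longrightarrow> i \<notin> S \<Longrightarrow> commuting_prod f (insert i S) = f i * commuting_prod f S"
  unfolding commuting_prod_def by (rule comp_fun_commute_on.fold_insert[OF comp_fun_commute_mult]) simp_all

lemma prod_commute:
  assumes "finite S" "\<And>i. i \<in> S \<Longrightarrow> a * f i = f i * a"
  shows "a * commuting_prod f S = commuting_prod f S * a"
  using assms
proof (induction S)
  case (insert i S)
  have "a * (f i * commuting_prod f S) = f i * (a * commuting_prod f S)"
    using insert.prems[of i] by (simp flip: mult.assoc)
  also have "a * commuting_prod f S = commuting_prod f S * a"
    by (rule insert.IH) (simp add: insert.prems)
  finally show ?case using insert.hyps by (simp add: prod_insert mult.assoc)
qed simp

end

locale commuting_involutions = commuting_family f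
  for f :: "'i \<Rightarrow> 'a::monoid_mult" +
  assumes square: "f i * f i = 1"
begin

lemma mult_prod:
  assumes "finite S"
  shows "f i * commuting_prod f S = commuting_prod f (sym_diff {i} S)"
proof (cases "i \<in> S")
  case True
  then have "commuting_prod f S = f i * commuting_prod f (S - {i})"
    using prod_insert[of "S - {i}" i] assms by (simp add: insert_absorb)
  then have "f i * commuting_prod f S = commuting_prod f (S - {i})"
    by (simp add: square flip: mult.assoc)
  also have "S - {i} = sym_diff {i} S" using True by auto
  finally show ?thesis .
next
  case False
  then have "sym_diff {i} S = insert i S" by auto
  with False show ?thesis using prod_insert[OF assms] by simp
qed

text \<open>Common factors square to 1, so finite products multiply like finite sets under symmetric
  difference; all index computations below are thus modulo 2.\<close>

lemma prod_mult:
  assumes "finite S" "finite T"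
  shows "commuting_prod f S * commuting_prod f T = commuting_prod f (sym_diff S T)"
  using assms(1)
proof (induction S)
  case (insert i S)
  have "commuting_prod f (insert i S) * commuting_prod f T = f i * commuting_prod f (sym_diff S T)"
    by (simp only: prod_insert[OF insert.hyps] mult.assoc insert.IH)
  also have "\<dots> = commuting_prod f (sym_diff {i} (sym_diff S T))"
    by (rule mult_prod) (use insert.hyps assms(2) in auto)
  also have "sym_diff {i} (sym_diff S T) = sym_diff (insert i S) T" using insert.hyps by auto
  finally show ?case .
qed simp

lemma prod_square: "finite S \<Longrightarrow> commuting_prod f S * commuting_prod f S = 1"
  by (simp add: prod_mult)

end

lemma adj_commuting_prod:
  fixes f :: "'i \<Rightarrow> 'a::cstar_algebra"
  assumes "commuting_family f" "finite S" "\<And>i. i \<in> S \<Longrightarrow> adj (f i) = f i"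
  shows "adj (commuting_prod f S) = commuting_prod f S"
proof -
  interpret commuting_family f by fact
  show ?thesis using assms(2,3)
  proof (induction S)
    case (insert i S)
    then show ?case
      using prod_commute[of S "f i"] by (simp add: prod_insert adj_mult commute)
  qed simp
qed

section \<open>Generating systems of Pauli operators\<close>

locale pauli_system =
  fixes x z :: "'i::countable \<Rightarrow> 'a::cstar_algebra"
  assumes adj_x: "adj (x i) = x i" and adj_z: "adj (z i) = z i"
    and x_sq: "x i * x i = 1" and z_sq: "z i * z i = 1"
    and x_comm: "x i * x j = x j * x i" and z_comm: "z i * z j = z j * z i"
    and xz_comm: "i \<noteq> j \<Longrightarrow> x i * z j = z j * x i"
    and xz_anti: "x i * z i = - (z i * x i)"
    and gen: "cstar_subalgebra hull (range x \<union> range z) = UNIV"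
begin

sublocale X: commuting_involutions x
  by unfold_locales (auto simp: x_comm x_sq)

sublocale Z: commuting_involutions z
  by unfold_locales (auto simp: z_comm z_sq)

definition diag :: "'a set" where "diag = cstar_subalgebra hull (range z)"

abbreviation xp :: "'i set \<Rightarrow> 'a" where "xp \<equiv> commuting_prod x"
abbreviation zp :: "'i set \<Rightarrow> 'a" where "zp \<equiv> commuting_prod z"

lemma adj_xp: "finite S \<Longrightarrow> adj (xp S) = xp S"
  by (rule adj_commuting_prod) (auto simp: adj_x X.commuting_family_axioms)

lemma xp_z_commute: "finite S \<Longrightarrow> i \<notin> S \<Longrightarrow> z i * xp S = xp S * z i"
  by (rule X.prod_commute) (metis xz_comm)+

lemma xp_z_anti:
  assumes "finite S" "i \<in> S"
  shows "z i * xp S = - (xp S * z i)"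
proof -
  have S: "xp S = x i * xp (S - {i})"
    using X.prod_insert[of "S - {i}" i] assms by (simp add: insert_absorb)
  have "z i * (x i * xp (S - {i})) = - (x i * (z i * xp (S - {i})))"
    using xz_anti[of i] by (simp flip: mult.assoc)
  also have "z i * xp (S - {i}) = xp (S - {i}) * z i"
    using assms by (intro xp_z_commute) auto
  finally show ?thesis unfolding S by (simp add: mult.assoc)
qed

lemma zp_x_commute: "finite S \<Longrightarrow> i \<notin> S \<Longrightarrow> x i * zp S = zp S * x i"
  by (rule Z.prod_commute) (metis xz_comm)+

lemma diag_subalgebra: "cstar_subalgebra diag"
  unfolding diag_def by (rule cstar_subalgebra_hull)

lemmas diag_ops = subalgebra_add[OF diag_subalgebra] subalgebra_mult[OF diag_subalgebra]
  subalgebra_scaleC[OF diag_subalgebra] subalgebra_scaleR[OF diag_subalgebra]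
  subalgebra_adj[OF diag_subalgebra] subalgebra_minus[OF diag_subalgebra]
  subalgebra_diff[OF diag_subalgebra] subalgebra_zero[OF diag_subalgebra]

lemma z_diag: "z i \<in> diag"
  unfolding diag_def by (rule hull_inc) simp

lemma one_diag: "1 \<in> diag"
  using diag_ops(2)[OF z_diag z_diag] z_sq by metis

lemma diag_comm: "a \<in> diag \<Longrightarrow> b \<in> diag \<Longrightarrow> a * b = b * a"
  unfolding diag_def by (rule hull_commutative) (auto simp: adj_z z_comm)

text \<open>Conjugation by \<open>xp S\<close> sends each \<open>z i\<close> to itself or its
  negative, so the preimage of \<open>diag\<close> is a subalgebra containing the
  generators.\<close>

lemma xp_conj_diag:
  assumes S: "finite S" and d: "d \<in> diag"
  shows "xp S * d * xp S \<in> diag"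
proof -
  have "xp S * z i * xp S \<in> diag" for i
  proof (cases "i \<in> S")
    case True
    have "xp S * z i * xp S = xp S * - (xp S * z i)"
      by (simp add: xp_z_anti[OF S True] mult.assoc)
    also have "\<dots> = - ((xp S * xp S) * z i)" by (simp add: mult.assoc)
    finally show ?thesis by (simp add: X.prod_square S z_diag diag_ops)
  next
    case False
    have "xp S * z i * xp S = z i * (xp S * xp S)"
      by (simp add: mult.assoc flip: xp_z_commute[OF S False])
    then show ?thesis by (simp add: X.prod_square S z_diag)
  qed
  then have "diag \<subseteq> (\<lambda>a. xp S * a * xp S) -` diag"
    \<comment> \<open>Unfolds only the left occurrence of \<open>diag\<close>; the one inside the
      preimage stays folded.\<close>
    unfolding diag_def[THEN arg_cong, of "\<lambda>A. A \<subseteq> _"]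
    by (intro cstar_subalgebra_hull_minimal cstar_subalgebra_vimage isometric_automorphism_inner
        adj_xp X.prod_square S diag_subalgebra) auto
  with d show ?thesis by auto
qed

lemma diag_xp:
  assumes "finite S" "d \<in> diag"
  shows "d * xp S = xp S * (xp S * d * xp S)"
proof -
  have "xp S * (xp S * d * xp S) = (xp S * xp S) * d * xp S" by (simp only: mult.assoc)
  then show ?thesis by (simp add: X.prod_square assms)
qed

text \<open>The algebraic crossed product of the diagonal by the group of finite flips
  \<open>xp S\<close>. The coefficients range over the whole closed diagonal, so the expectation
  just reads off the coefficient of the empty set.\<close>

definition local_elements :: "'a set" where
  "local_elements = {\<Sum>S\<in>F. xp S * d S | F d. finite F \<and> (\<forall>S\<in>F. finite S \<and> d S \<in> diag)}"

lemma local_elementsI: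
  "finite F \<Longrightarrow> (\<And>S. S \<in> F \<Longrightarrow> finite S \<and> d S \<in> diag) \<Longrightarrow> (\<Sum>S\<in>F. xp S * d S) \<in> local_elements"
  unfolding local_elements_def by blast

lemma local_elementsE:
  assumes "a \<in> local_elements"
  obtains F d where "finite F" "\<And>S. S \<in> F \<Longrightarrow> finite S" "\<And>S. S \<in> F \<Longrightarrow> d S \<in> diag"
    "a = (\<Sum>S\<in>F. xp S * d S)"
  using assms unfolding local_elements_def by blast

lemma local_base: "finite S \<Longrightarrow> d \<in> diag \<Longrightarrow> xp S * d \<in> local_elements"
  using local_elementsI[of "{S}" "\<lambda>_. d"] by simp

lemma local_zero: "0 \<in> local_elements"
  using local_elementsI[of "{}"] by simp

lemma local_add:
  assumes "a \<in> local_elements" "b \<in> local_elements"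
  shows "a + b \<in> local_elements"
proof -
  obtain F d where a: "finite F" "\<And>S. S \<in> F \<Longrightarrow> finite S" "\<And>S. S \<in> F \<Longrightarrow> d S \<in> diag"
    "a = (\<Sum>S\<in>F. xp S * d S)" using local_elementsE[OF assms(1)] by metis
  obtain F' d' where b: "finite F'" "\<And>S. S \<in> F' \<Longrightarrow> finite S" "\<And>S. S \<in> F' \<Longrightarrow> d' S \<in> diag"
    "b = (\<Sum>S\<in>F'. xp S * d' S)" using local_elementsE[OF assms(2)] by metis
  \<comment> \<open>Both coefficient families are padded by 0 to the common index set.\<close>
  let ?d = "\<lambda>S. (if S \<in> F then d S else 0)" and ?d' = "\<lambda>S. (if S \<in> F' then d' S else 0)"
  have "a = (\<Sum>S\<in>F \<union> F'. xp S * ?d S)"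
    unfolding a(4) by (rule sum.mono_neutral_cong_left) (use a b in auto)
  moreover have "b = (\<Sum>S\<in>F \<union> F'. xp S * ?d' S)"
    unfolding b(4) by (rule sum.mono_neutral_cong_left) (use a b in auto)
  ultimately have "a + b = (\<Sum>S\<in>F \<union> F'. xp S * (?d S + ?d' S))"
    by (simp only: sum.distrib distrib_left)
  also have "\<dots> \<in> local_elements"
    using a(1-3) b(1-3) by (intro local_elementsI) (auto intro!: diag_ops)
  finally show ?thesis .
qed

lemma local_sum: "(\<And>i. i \<in> I \<Longrightarrow> f i \<in> local_elements) \<Longrightarrow> (\<Sum>i\<in>I. f i) \<in> local_elements"
  by (induction I rule: infinite_finite_induct) (auto intro: local_zero local_add)

text \<open>Products and adjoints return to normal form because \<open>diag_xp\<close> moves a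
  diagonal coefficient past a flip at the price of conjugating it.\<close>

lemma local_subalgebra: "cstar_subalgebra (closure local_elements)"
proof (rule cstar_subalgebra_closure)
  fix a b assume "a \<in> local_elements" "b \<in> local_elements"
  then show "a + b \<in> local_elements" by (rule local_add)
next
  fix a b assume a: "a \<in> local_elements" and b: "b \<in> local_elements"
  obtain F d where a: "finite F" "\<And>S. S \<in> F \<Longrightarrow> finite S" "\<And>S. S \<in> F \<Longrightarrow> d S \<in> diag"
    "a = (\<Sum>S\<in>F. xp S * d S)" using local_elementsE[OF a] by metis
  obtain F' d' where b: "finite F'" "\<And>S. S \<in> F' \<Longrightarrow> finite S" "\<And>S. S \<in> F' \<Longrightarrow> d' S \<in> diag"
    "b = (\<Sum>S\<in>F'. xp S * d' S)" using local_elementsE[OF b] by metis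
  have "(xp S * d S) * (xp T * d' T) \<in> local_elements" if "S \<in> F" "T \<in> F'" for S T
  proof -
    have "(xp S * d S) * (xp T * d' T) = xp S * (d S * xp T) * d' T"
      by (simp only: mult.assoc)
    also have "\<dots> = (xp S * xp T) * ((xp T * d S * xp T) * d' T)"
      unfolding diag_xp[OF b(2)[OF that(2)] a(3)[OF that(1)]] by (simp only: mult.assoc)
    also have "xp S * xp T = xp (sym_diff S T)"
      using that a b by (intro X.prod_mult) auto
    finally show ?thesis
      using that a b by (auto intro!: local_base diag_ops(2)[OF xp_conj_diag])
  qed
  then show "a * b \<in> local_elements"
    unfolding a(4) b(4) sum_product by (intro local_sum)
next
  fix c a assume "a \<in> local_elements"
  then obtain F d where a: "finite F" "\<And>S. S \<in> F \<Longrightarrow> finite S" "\<And>S. S \<in> F \<Longrightarrow> d S \<in> diag"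
    "a = (\<Sum>S\<in>F. xp S * d S)" using local_elementsE by metis
  have "c *\<^sub>C a = (\<Sum>S\<in>F. xp S * (c *\<^sub>C d S))"
    unfolding a(4) mult_scaleC_right
    by (rule linear_sum[OF bounded_linear.linear[OF bounded_linear_scaleC]])
  then show "c *\<^sub>C a \<in> local_elements" using a by (auto intro!: local_elementsI diag_ops)
next
  fix a assume "a \<in> local_elements"
  then obtain F d where a: "finite F" "\<And>S. S \<in> F \<Longrightarrow> finite S" "\<And>S. S \<in> F \<Longrightarrow> d S \<in> diag"
    "a = (\<Sum>S\<in>F. xp S * d S)" using local_elementsE by metis
  have "adj (xp S * d S) \<in> local_elements" if "S \<in> F" for S
    using that a by (simp add: adj_mult adj_xp diag_xp diag_ops local_base xp_conj_diag)
  then show "adj a \<in> local_elements"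
    unfolding a(4) adj_sum by (intro local_sum)
qed (rule local_zero)

lemma local_dense: "closure local_elements = UNIV"
proof -
  have "x i \<in> local_elements" for i
    using local_base[of "{i}" 1] X.prod_insert[of "{}" i] by (simp add: one_diag)
  moreover have "z i \<in> local_elements" for i
    using local_base[of "{}" "z i"] by (simp add: z_diag)
  ultimately have "range x \<union> range z \<subseteq> closure local_elements"
    using closure_subset by blast
  then have "cstar_subalgebra hull (range x \<union> range z) \<subseteq> closure local_elements"
    by (rule cstar_subalgebra_hull_minimal[OF _ local_subalgebra])
  then show ?thesis by (simp add: gen top.extremum_unique)
qed

lemma closed_contains_all: "local_elements \<subseteq> C \<Longrightarrow> closed C \<Longrightarrow> a \<in> C"
  using local_dense closure_minimal by blast

subsection \<open>The conditional expectation onto the diagonal\<close>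

abbreviation Zn :: "nat \<Rightarrow> 'a" where "Zn n \<equiv> z (from_nat n)"

text \<open>Each stage averages over conjugation by one more \<open>z\<close>, keeping what commutes
  with it and killing what anticommutes. Countability of the index type supplies the
  enumeration.\<close>

primrec pinch :: "nat \<Rightarrow> 'a \<Rightarrow> 'a" where
  "pinch 0 a = a"
| "pinch (Suc n) a = (1/2) *\<^sub>R (pinch n a + Zn n * pinch n a * Zn n)"

lemma pinch_add: "pinch n (a + b) = pinch n a + pinch n b"
  by (induction n) (simp_all add: algebra_simps)

lemma pinch_scaleC: "pinch n (c *\<^sub>C a) = c *\<^sub>C pinch n a"
  by (induction n)
    (simp_all add: scaleR_scaleC scaleC_scaleC scaleC_add_right mult_scaleC_left mult_scaleC_right mult.commute)

lemma pinch_norm: "norm (pinch n a) \<le> norm a"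
proof (induction n)
  case (Suc n)
  have "norm (pinch n a + Zn n * pinch n a * Zn n) \<le> norm (pinch n a) + norm (pinch n a)"
    using norm_triangle_ineq[of "pinch n a" "Zn n * pinch n a * Zn n"]
    by (simp add: norm_conj_unitary adj_z z_sq)
  with Suc show ?case by simp
qed simp

lemma pinch_diag_left: "d \<in> diag \<Longrightarrow> pinch n (d * a) = d * pinch n a"
proof (induction n)
  case (Suc n)
  have "Zn n * (d * pinch n a) * Zn n = d * (Zn n * pinch n a * Zn n)"
    using diag_comm[OF Suc.prems z_diag] by (simp flip: mult.assoc)
  with Suc show ?case by (simp add: algebra_simps)
qed simp

lemma pinch_fixed:
  assumes "\<And>i. z i * a = a * z i"
  shows "pinch n a = a"
proof (induction n)
  case (Suc n)
  have "Zn n * a * Zn n = a" by (simp add: assms mult.assoc z_sq)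
  with Suc show ?case by (simp flip: scaleR_2)
qed simp

lemma pinch_anti:
  assumes "z i * a = - (a * z i)"
  shows "z i * pinch n a = - (pinch n a * z i)"
proof (induction n)
  case (Suc n)
  have "z i * (Zn n * pinch n a * Zn n) = Zn n * (z i * pinch n a) * Zn n"
    by (metis mult.assoc z_comm)
  also have "\<dots> = - (Zn n * pinch n a * (z i * Zn n))"
    by (simp add: Suc mult.assoc)
  also have "z i * Zn n = Zn n * z i" by (rule z_comm)
  finally have "z i * (Zn n * pinch n a * Zn n) = - ((Zn n * pinch n a * Zn n) * z i)"
    by (simp add: mult.assoc)
  with Suc show ?case by (simp add: algebra_simps)
qed (simp add: assms)

text \<open>Anticommutation with \<open>z i\<close> survives the other averagings, since the
  \<open>z\<close> commute. The averaging over \<open>z i\<close> itself is done in passing from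
  stage \<open>to_nat i\<close> to the next, hence the strict inequality.\<close>

lemma pinch_anti_zero:
  assumes "z i * a = - (a * z i)" "n > to_nat i"
  shows "pinch n a = 0"
  using assms(2)
proof (induction n)
  case (Suc n)
  show ?case
  proof (cases "n = to_nat i")
    case True
    then have "Zn n * pinch n a * Zn n = - (pinch n a * (Zn n * Zn n))"
      using pinch_anti[OF assms(1), of n] by (simp add: mult.assoc)
    then show ?thesis by (simp add: z_sq)
  next
    case False
    with Suc show ?thesis by simp
  qed
qed simp

lemma pinch_xp:
  assumes "finite S" "S \<noteq> {}" "d \<in> diag"
  shows "\<exists>N. \<forall>n\<ge>N. pinch n (xp S * d) = 0"
proof -
  obtain i where i: "i \<in> S" using assms by blast
  have "z i * (xp S * d) = - (xp S * (z i * d))"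
    using xp_z_anti[OF assms(1) i] by (simp flip: mult.assoc)
  also have "z i * d = d * z i" by (intro diag_comm z_diag assms)
  finally have "z i * (xp S * d) = - ((xp S * d) * z i)" by (simp add: mult.assoc)
  from pinch_anti_zero[OF this] show ?thesis by (meson less_eq_Suc_le)
qed

lemma pinch_sum: "pinch n (\<Sum>i\<in>I. f i) = (\<Sum>i\<in>I. pinch n (f i))"
proof -
  have "pinch n 0 = 0" using pinch_norm[of n 0] by simp
  then show ?thesis
    by (induction I rule: infinite_finite_induct) (simp_all add: pinch_add)
qed

lemma pinch_diag: "d \<in> diag \<Longrightarrow> pinch n d = d"
  by (rule pinch_fixed) (simp add: diag_comm z_diag)

lemma pinch_diff: "pinch n (a - b) = pinch n a - pinch n b"
  by (metis add_diff_cancel_right' diff_add_cancel pinch_add)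

text \<open>Averages of a local element are eventually constant; contractivity and density extend
  this to all elements as the Cauchy property.\<close>

lemma pinch_Cauchy: "Cauchy (\<lambda>n. pinch n a)"
proof (rule metric_CauchyI)
  fix e :: real assume e: "e > 0"
  then obtain b where b: "b \<in> local_elements" "dist b a < e/2"
    using local_dense closure_approachable[of a local_elements] by (metis UNIV_I half_gt_zero)
  obtain F d where F: "finite F" "\<And>S. S \<in> F \<Longrightarrow> finite S" "\<And>S. S \<in> F \<Longrightarrow> d S \<in> diag"
    "b = (\<Sum>S\<in>F. xp S * d S)" using local_elementsE[OF b(1)] by metis
  have "\<exists>N. \<forall>n\<ge>N. pinch n (xp S * d S) = pinch N (xp S * d S)" if "S \<in> F" for S
  proof (cases "S = {}")
    case True
    with F that show ?thesis by (simp add: pinch_diag)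
  next
    case False
    from pinch_xp[OF F(2)[OF that] False F(3)[OF that]] show ?thesis by (metis order_refl)
  qed
  then obtain N where N: "\<And>S n. S \<in> F \<Longrightarrow> n \<ge> N S \<Longrightarrow> pinch n (xp S * d S) = pinch (N S) (xp S * d S)"
    by metis
  \<comment> \<open>The inserted 0 covers an empty \<open>F\<close>.\<close>
  define M where "M = Max (insert 0 (N ` F))"
  have M: "M \<ge> N S" if "S \<in> F" for S using that F(1) by (simp add: M_def)
  have const: "pinch n b = pinch M b" if "n \<ge> M" for n
    unfolding F(4) pinch_sum
  proof (rule sum.cong)
    fix S assume S: "S \<in> F"
    show "pinch n (xp S * d S) = pinch M (xp S * d S)"
      using N[OF S order_trans[OF M[OF S] that]] N[OF S M[OF S]] by (rule trans[OF _ sym])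
  qed simp
  have close: "dist (pinch n a) (pinch n b) < e/2" for n
    using pinch_norm[of n "a - b"] b(2) by (simp add: dist_norm pinch_diff norm_minus_commute)
  show "\<exists>M. \<forall>m\<ge>M. \<forall>n\<ge>M. dist (pinch m a) (pinch n a) < e"
  proof (intro exI allI impI)
    fix m n assume "m \<ge> M" "n \<ge> M"
    then have "pinch m b = pinch n b" using const by metis
    then show "dist (pinch m a) (pinch n a) < e"
      using close[of m] close[of n] dist_triangle_half_l by metis
  qed
qed

definition cond_exp :: "'a \<Rightarrow> 'a" where "cond_exp a = lim (\<lambda>n. pinch n a)"

lemma pinch_tendsto: "(\<lambda>n. pinch n a) \<longlonglongrightarrow> cond_exp a"
  unfolding cond_exp_def using pinch_Cauchy Cauchy_convergent_iff convergent_LIMSEQ_iff by blast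

lemma cond_exp_eqI: "(\<And>n. n \<ge> N \<Longrightarrow> pinch n a = b) \<Longrightarrow> cond_exp a = b"
  by (rule LIMSEQ_unique[OF pinch_tendsto], rule tendsto_eventually)
    (auto simp: eventually_sequentially)

lemma cond_exp_add: "cond_exp (a + b) = cond_exp a + cond_exp b"
  using LIMSEQ_unique[OF pinch_tendsto, of "a + b"] tendsto_add[OF pinch_tendsto[of a] pinch_tendsto[of b]]
  by (simp add: pinch_add)

lemma cond_exp_scaleC: "cond_exp (c *\<^sub>C a) = c *\<^sub>C cond_exp a"
  using LIMSEQ_unique[OF pinch_tendsto, of "c *\<^sub>C a"]
    bounded_linear.tendsto[OF bounded_linear_scaleC pinch_tendsto[of a], of c]
  by (simp add: pinch_scaleC)

lemma cond_exp_norm: "norm (cond_exp a) \<le> norm a"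
  by (rule Lim_bounded[OF tendsto_norm[OF pinch_tendsto]]) (simp add: pinch_norm)

lemma bounded_linear_cond_exp: "bounded_linear cond_exp"
  by (rule bounded_linear_intro[where K = 1])
    (simp_all add: cond_exp_add cond_exp_norm scaleR_scaleC cond_exp_scaleC)

lemma cond_exp_diag_left: "d \<in> diag \<Longrightarrow> cond_exp (d * a) = d * cond_exp a"
  using LIMSEQ_unique[OF pinch_tendsto, of "d * a"] tendsto_mult[OF tendsto_const pinch_tendsto[of a]]
  by (simp add: pinch_diag_left)

lemma cond_exp_fixed: "(\<And>i. z i * a = a * z i) \<Longrightarrow> cond_exp a = a"
  by (rule cond_exp_eqI) (rule pinch_fixed)

lemma cond_exp_diag: "d \<in> diag \<Longrightarrow> cond_exp d = d"
  by (rule cond_exp_fixed) (simp add: diag_comm z_diag)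

lemma cond_exp_xp:
  assumes "finite S" "d \<in> diag"
  shows "cond_exp (xp S * d) = (if S = {} then d else 0)"
  using pinch_xp[OF assms(1) _ assms(2)] assms(2) by (auto simp: cond_exp_diag intro: cond_exp_eqI)

lemma cond_exp_sum: "cond_exp (\<Sum>i\<in>I. f i) = (\<Sum>i\<in>I. cond_exp (f i))"
  by (rule linear_sum[OF bounded_linear.linear[OF bounded_linear_cond_exp]])

lemma continuous_cond_exp: "continuous_on UNIV cond_exp"
  by (rule linear_continuous_on[OF bounded_linear_cond_exp])

text \<open>On a local element only the diagonal coefficient of the empty set survives; the diagonal
  is closed and local elements are dense.\<close>

lemma cond_exp_in_diag: "cond_exp a \<in> diag"
proof -
  have "local_elements \<subseteq> cond_exp -` diag"
    by (auto elim!: local_elementsE simp: cond_exp_sum cond_exp_xp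
        intro!: subalgebra_sum[OF diag_subalgebra] diag_ops)
  moreover have "closed (cond_exp -` diag)"
    by (intro closed_vimage continuous_cond_exp subalgebra_closed diag_subalgebra)
  ultimately show ?thesis using closed_contains_all by blast
qed

text \<open>This makes every state of the diagonal positive on \<open>cond_exp (adj a * a)\<close> for local \<open>a\<close>, so no
  spectral theory is needed to extend states.\<close>

lemma cond_exp_square:
  assumes "a \<in> local_elements"
  shows "\<exists>(F :: 'i set set) d. (\<forall>S\<in>F. d S \<in> diag) \<and> cond_exp (adj a * a) = (\<Sum>S\<in>F. adj (d S) * d S)"
proof -
  obtain F d where a: "finite F" "\<And>S. S \<in> F \<Longrightarrow> finite S" "\<And>S. S \<in> F \<Longrightarrow> d S \<in> diag"
    "a = (\<Sum>S\<in>F. xp S * d S)" using local_elementsE[OF assms] by metis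
  have E: "cond_exp (adj (xp S * d S) * (xp T * d T)) = (if S = T then adj (d S) * d T else 0)"
    if "S \<in> F" "T \<in> F" for S T
  proof -
    have "adj (xp S * d S) * (xp T * d T) = adj (d S) * ((xp S * xp T) * d T)"
      using that a by (simp add: adj_mult adj_xp mult.assoc)
    also have "xp S * xp T = xp (sym_diff S T)" using that a by (intro X.prod_mult) auto
    finally have "cond_exp (adj (xp S * d S) * (xp T * d T)) =
      adj (d S) * cond_exp (xp (sym_diff S T) * d T)"
      using that a by (simp add: cond_exp_diag_left diag_ops)
    also have "cond_exp (xp (sym_diff S T) * d T) = (if sym_diff S T = {} then d T else 0)"
      using that a by (intro cond_exp_xp) auto
    also have "sym_diff S T = {} \<longleftrightarrow> S = T" by blast
    finally show ?thesis by auto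
  qed
  have "cond_exp (adj a * a) = (\<Sum>S\<in>F. \<Sum>T\<in>F. cond_exp (adj (xp S * d S) * (xp T * d T)))"
    unfolding a(4) adj_sum sum_product cond_exp_sum ..
  also have "\<dots> = (\<Sum>S\<in>F. \<Sum>T\<in>F. if S = T then adj (d S) * d T else 0)"
    by (intro sum.cong refl E)
  also have "\<dots> = (\<Sum>S\<in>F. adj (d S) * d S)" using a(1) by simp
  finally have "cond_exp (adj a * a) = (\<Sum>S\<in>F. adj (d S) * d S)" .
  with a(3) show ?thesis by (intro exI[of _ F] exI[of _ d]) simp
qed

subsection \<open>The diagonal is a $C^*$-diagonal\<close>

text \<open>Whatever commutes with every \<open>z i\<close> is fixed by all averagings, hence equals
  its own expectation.\<close>

lemma relative_commutant_diag: "relative_commutant diag = diag"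
proof
  show "relative_commutant diag \<subseteq> diag"
  proof
    fix a assume "a \<in> relative_commutant diag"
    then have "z i * a = a * z i" for i using z_diag by (simp add: relative_commutant_def)
    then have "cond_exp a = a" by (rule cond_exp_fixed)
    then show "a \<in> diag" using cond_exp_in_diag by metis
  qed
qed (auto simp: relative_commutant_def diag_comm)

lemma regular_masa_diag: "regular_masa diag"
proof -
  have x: "x i \<in> normalizers diag" for i
    using xp_conj_diag[of "{i}"] X.prod_insert[of "{}" i] by (simp add: normalizers_def adj_x)
  have z: "z i \<in> normalizers diag" for i
    by (auto simp: normalizers_def adj_z intro!: diag_ops z_diag)
  have "cstar_subalgebra hull (range x \<union> range z) \<subseteq> cstar_subalgebra hull (normalizers diag)"
    using x z by (intro hull_mono) auto
  then show ?thesis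
    unfolding regular_masa_def gen using diag_subalgebra diag_comm relative_commutant_diag by auto
qed

text \<open>Compressing \<phi> to the two spectral projections of \<open>z i\<close> writes it as a
  convex combination with weights t and 1 - t; purity excludes 0 < t < 1.\<close>

lemma pure_state_z:
  assumes "pure_state_on diag \<phi>"
  shows "\<phi> (z i) = 1 \<or> \<phi> (z i) = -1"
proof -
  interpret cstar_state diag \<phi>
    using assms by unfold_locales (auto simp: pure_state_on_def diag_subalgebra one_diag)
  define p where "p s = (1/2) *\<^sub>R (1 + s *\<^sub>R z i)" for s :: real
  have pD: "p s \<in> diag" for s unfolding p_def by (intro diag_ops one_diag z_diag)
  have proj: "adj (p s) = p s" "p s * p s = p s" if "s * s = 1" for s
    using that by (simp_all add: p_def adj_add adj_z algebra_simps z_sq flip: scaleR_2)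
  have split: "p 1 + p (-1) = 1"
    by (simp add: p_def scaleR_add_right scaleR_diff_right flip: scaleR_add_left)
  have pp: "adj (p s * a) * (p s * a) = p s * (adj a * a)" if "s * s = 1" "a \<in> diag" for s a
  proof -
    have "adj (p s * a) * (p s * a) = adj a * (p s * p s) * a"
      by (simp only: adj_mult proj(1)[OF that(1)] mult.assoc)
    also have "\<dots> = (adj a * p s) * a" by (simp only: proj(2)[OF that(1)])
    also have "adj a * p s = p s * adj a" by (intro diag_comm pD diag_ops that)
    finally show ?thesis by (simp only: mult.assoc)
  qed
  have nonneg: "\<phi> (p s * (adj a * a)) \<in> \<real>\<^sub>\<ge>\<^sub>0" if "s * s = 1" "a \<in> diag" for s a
    using pos[of "p s * a"] that pp[OF that] pD by (simp add: diag_ops)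
  define t where "t = Re (\<phi> (p 1))"
  have "\<phi> (p s) \<in> \<real>\<^sub>\<ge>\<^sub>0" if "s * s = 1" for s
    using nonneg[OF that one_diag] by simp
  from this[of 1] this[of "-1"] have t0: "\<phi> (p 1) = of_real t" "t \<ge> 0" and q: "\<phi> (p (-1)) \<in> \<real>\<^sub>\<ge>\<^sub>0"
    by (auto simp: t_def complex_nonneg_Reals_iff complex_eq_iff)
  have sum1: "\<phi> (p 1) + \<phi> (p (-1)) = 1"
    using add[OF pD pD] split one by metis
  then have t1: "\<phi> (p (-1)) = of_real (1 - t)" using t0 by (simp add: algebra_simps)
  with q have t2: "t \<le> 1" by (simp add: complex_nonneg_Reals_iff)
  have "t = 0 \<or> t = 1"
  proof (rule ccontr)
    assume "\<not> (t = 0 \<or> t = 1)"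
    with t0 t2 have t: "0 < t" "t < 1" by auto
    have st: "state_on diag (\<lambda>a. of_real (1 / r) * \<phi> (p s * a))"
      if "s * s = 1" "r > 0" "\<phi> (p s) = of_real r" for s r
      unfolding state_on_def
      using that nonneg[OF that(1)] pD
      by (auto simp: distrib_left add scale diag_ops mult_scaleC_right
          intro!: nonneg_Reals_mult_I simp: algebra_simps add_divide_distrib)
    have "\<phi> b = of_real t * (of_real (1 / t) * \<phi> (p 1 * b))
        + of_real (1 - t) * (of_real (1 / (1 - t)) * \<phi> (p (-1) * b))" if "b \<in> diag" for b
    proof -
      have "\<phi> ((p 1 + p (-1)) * b) = \<phi> (p 1 * b) + \<phi> (p (-1) * b)"
        using that pD by (simp add: distrib_right add diag_ops)
      with t show ?thesis
        by (simp add: split flip: mult.assoc of_real_mult)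
    qed
    \<comment> \<open>Purity, evaluated at \<open>p 1\<close>: the first compressed state gives it
      the value 1, while \<phi> gives it t.\<close>
    then have "of_real (1 / t) * \<phi> (p 1 * p 1) = \<phi> (p 1)"
      using assms st[of 1 t] st[of "-1" "1 - t"] t t0 t1 pD unfolding pure_state_on_def
      by (metis (mono_tags, lifting) diff_gt_0_iff_gt mult_1 mult_minus1_right minus_minus)
    then have "1 = t" using t t0 proj(2)[of 1] by (simp flip: of_real_mult)
    with t show False by simp
  qed
  moreover have "\<phi> (z i) = \<phi> (p 1) - \<phi> (p (-1))"
  proof -
    have "p 1 - p (-1) = z i" by (simp add: p_def algebra_simps flip: scaleR_2)
    then show ?thesis using diff[OF pD pD] by metis
  qed
  ultimately show ?thesis using t0 t1 by auto
qed

text \<open>As \<phi> takes the value s = 1 or s = -1 on \<open>z i\<close>, Cauchy-Schwarz lets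
  \<psi> pull \<open>z i\<close> out on either side as the factor s. A monomial
  \<open>xp S * d\<close> with i in S anticommutes with \<open>z i\<close>, so \<psi> vanishes on
  it. Purity is required of \<phi> only, which serves below to identify the components of a
  decomposition too.\<close>

lemma state_extension_unique:
  assumes \<phi>: "pure_state_on diag \<phi>" and \<psi>: "state_on UNIV \<psi>" and ext: "\<And>d. d \<in> diag \<Longrightarrow> \<psi> d = \<phi> d"
  shows "\<psi> a = \<phi> (cond_exp a)"
proof -
  interpret cstar_state UNIV \<psi>
    using \<psi> by unfold_locales (auto simp: cstar_subalgebra_def)
  have xp: "\<psi> (xp S * d) = 0" if S: "finite S" "S \<noteq> {}" and d: "d \<in> diag" for S d
  proof -
    obtain i where i: "i \<in> S" using S by blast
    obtain s :: real where s: "\<psi> (z i) = of_real s" "s * s = 1"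
      using pure_state_z[OF \<phi>, of i] ext[OF z_diag] by (metis mult_1 mult_minus1 minus_minus of_real_1 of_real_minus)
    \<comment> \<open>The deviation of \<open>z i\<close> from its expected value; its variance
      vanishes because s squares to 1.\<close>
    define k where "k = z i - s *\<^sub>R 1"
    have adj_k: "adj k = k" by (simp add: k_def adj_diff adj_z)
    have "k * k = 2 *\<^sub>R 1 - (2 * s) *\<^sub>R z i"
      using s(2) by (simp add: k_def algebra_simps z_sq scaleR_2 flip: scaleR_add_left)
    then have null: "\<psi> (adj k * k) = 0"
      using s by (simp add: adj_k diff scaleR_scaleC scale one mult.assoc flip: of_real_mult)
    have k1: "\<psi> (k * b) = 0" and k2: "\<psi> (b * k) = 0" for b
      using null_mult[of k b] null_mult[of k "adj b"] null by (simp_all add: adj_k adj_adj)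
    let ?b = "xp S * d"
    have z1: "\<psi> (z i * ?b) = of_real s * \<psi> ?b" "\<psi> (?b * z i) = of_real s * \<psi> ?b"
      using k1[of ?b] k2[of ?b]
      by (simp_all add: k_def left_diff_distrib right_diff_distrib diff scaleR_scaleC
          mult_scaleC_left mult_scaleC_right scale)
    have "z i * ?b = - (xp S * (z i * d))"
      using xp_z_anti[OF S(1) i] by (simp flip: mult.assoc)
    also have "z i * d = d * z i" by (intro diag_comm z_diag d)
    finally have "z i * ?b = - (?b * z i)" by (simp add: mult.assoc)
    then have "of_real s * \<psi> ?b = - (of_real s * \<psi> ?b)"
      using z1 minus[of "?b * z i"] by simp
    then show ?thesis using s(2) by auto
  qed
  have \<psi>_sum: "\<psi> (\<Sum>S\<in>F. f S) = (\<Sum>S\<in>F. \<psi> (f S))" for F and f :: "'i set \<Rightarrow> 'a"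
    by (induction F rule: infinite_finite_induct) (simp_all add: zero add)
  have loc: "\<psi> a = \<psi> (cond_exp a)" if "a \<in> local_elements" for a
  proof -
    have "\<psi> (xp S * d) = \<psi> (cond_exp (xp S * d))" if "finite S" "d \<in> diag" for S d
      using that by (cases "S = {}") (simp_all add: xp cond_exp_xp zero cond_exp_diag)
    then show ?thesis
      using that by (auto elim!: local_elementsE simp: cond_exp_sum \<psi>_sum intro!: sum.cong)
  qed
  have cont: "continuous_on UNIV \<psi>"
    unfolding continuous_on_iff dist_norm using cmod_diff_le order_le_less_trans by blast
  have "closed {a. \<psi> a = \<psi> (cond_exp a)}"
    by (intro closed_Collect_eq cont continuous_on_compose2[OF cont continuous_cond_exp]) auto
  with loc closed_contains_all[of "{a. \<psi> a = \<psi> (cond_exp a)}" a]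
  have "\<psi> a = \<psi> (cond_exp a)" by auto
  then show ?thesis by (simp add: ext cond_exp_in_diag)
qed

text \<open>Positivity holds on local elements by \<open>cond_exp_square\<close> and passes to
  limits, the expectation being contractive and states continuous.\<close>

lemma state_cond_exp:
  assumes "state_on diag \<phi>"
  shows "state_on UNIV (\<lambda>a. \<phi> (cond_exp a))"
proof -
  interpret cstar_state diag \<phi>
    using assms by unfold_locales (auto simp: diag_subalgebra one_diag)
  have le: "norm (\<phi> (cond_exp a) - \<phi> (cond_exp b)) \<le> norm (a - b)" for a b
    using cmod_diff_le[OF cond_exp_in_diag cond_exp_in_diag, of a b] cond_exp_norm[of "a - b"]
    by (simp add: linear_diff[OF bounded_linear.linear[OF bounded_linear_cond_exp]])
  have cont: "continuous_on UNIV (\<lambda>a. \<phi> (cond_exp a))"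
    unfolding continuous_on_iff dist_norm using le order_le_less_trans by blast
  have \<phi>_sum: "\<phi> (\<Sum>S\<in>F. f S) \<in> \<real>\<^sub>\<ge>\<^sub>0" if "\<And>S. S \<in> F \<Longrightarrow> f S \<in> diag \<and> \<phi> (f S) \<in> \<real>\<^sub>\<ge>\<^sub>0"
    for F and f :: "'i set \<Rightarrow> 'a"
    using that by (induction F rule: infinite_finite_induct)
      (auto simp: zero add subalgebra_sum[OF diag_subalgebra] intro!: nonneg_Reals_add_I)
  have "\<phi> (cond_exp (adj a * a)) \<in> \<real>\<^sub>\<ge>\<^sub>0" for a
  proof -
    let ?C = "{a. \<phi> (cond_exp (adj a * a)) \<in> \<real>\<^sub>\<ge>\<^sub>0}"
    have "a \<in> ?C" if a: "a \<in> local_elements" for a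
    proof -
      obtain F :: "'i set set" and d where Fd: "\<forall>S\<in>F. d S \<in> diag" "cond_exp (adj a * a) = (\<Sum>S\<in>F. adj (d S) * d S)"
        using cond_exp_square[OF a] by blast
      have "\<phi> (\<Sum>S\<in>F. adj (d S) * d S) \<in> \<real>\<^sub>\<ge>\<^sub>0"
        by (rule \<phi>_sum) (use Fd pos in \<open>auto intro!: diag_ops\<close>)
      with Fd(2) show ?thesis by simp
    qed
    moreover have "closed ?C"
    proof -
      have "continuous_on UNIV (\<lambda>a. \<phi> (cond_exp (adj a * a)))"
        by (rule continuous_on_compose2[OF cont _ subset_UNIV])
          (intro continuous_on_mult continuous_on_id linear_continuous_on bounded_linear_adj)
      from closed_vimage[OF closed_nonneg_Reals_complex this] show ?thesis by (simp add: vimage_def)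
    qed
    ultimately show ?thesis using closed_contains_all[of ?C a] by blast
  qed
  then show ?thesis
    by (simp add: state_on_def cond_exp_add cond_exp_scaleC add scale cond_exp_in_diag
        cond_exp_diag one_diag one)
qed

text \<open>The extension is \<phi> composed with the expectation. It is pure: the components of any
  decomposition restrict to \<phi> on the diagonal, and uniqueness among all states forces them to
  coincide with it.\<close>

theorem cstar_diagonal_diag: "cstar_diagonal diag"
  unfolding cstar_diagonal_def
proof (intro conjI allI impI regular_masa_diag)
  fix \<phi> assume \<phi>: "pure_state_on diag \<phi>"
  let ?\<psi> = "\<lambda>a. \<phi> (cond_exp a)"
  have "pure_state_on UNIV ?\<psi>"
    unfolding pure_state_on_def
  proof (intro conjI allI impI)
    show "state_on UNIV ?\<psi>" using state_cond_exp \<phi> by (simp add: pure_state_on_def)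
    fix \<psi> \<omega> t
    assume s: "state_on UNIV \<psi>" "state_on UNIV \<omega>" and t: "0 < t" "t < 1"
      and eq: "\<forall>b\<in>UNIV. ?\<psi> b = complex_of_real t * \<psi> b + complex_of_real (1 - t) * \<omega> b"
    have "state_on diag \<psi>" "state_on diag \<omega>" using s by (auto simp: state_on_def)
    moreover have "\<forall>b\<in>diag. \<phi> b = complex_of_real t * \<psi> b + complex_of_real (1 - t) * \<omega> b"
      using eq cond_exp_diag by (metis UNIV_I)
    ultimately have "\<forall>b\<in>diag. \<psi> b = \<phi> b \<and> \<omega> b = \<phi> b"
      using \<phi> t unfolding pure_state_on_def by blast
    then show "\<forall>b\<in>UNIV. \<psi> b = ?\<psi> b \<and> \<omega> b = ?\<psi> b"
      using state_extension_unique[OF \<phi> s(1)] state_extension_unique[OF \<phi> s(2)] by blast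
  qed
  moreover have "\<psi> = ?\<psi>" if "pure_state_on UNIV \<psi> \<and> (\<forall>b\<in>diag. \<psi> b = \<phi> b)" for \<psi>
    using state_extension_unique[OF \<phi>, of \<psi>] that unfolding pure_state_on_def by blast
  ultimately show "\<exists>!\<psi>. pure_state_on UNIV \<psi> \<and> (\<forall>b\<in>diag. \<psi> b = \<phi> b)"
    by (intro ex1I[of _ ?\<psi>]) (simp_all add: cond_exp_diag)
qed

end

lemma pauli_system_image:
  assumes \<alpha>: "isometric_automorphism \<alpha>" and "pauli_system x z"
  shows "pauli_system (\<alpha> \<circ> x) (\<alpha> \<circ> z)"
proof -
  interpret pauli_system x z by fact
  have "cstar_subalgebra hull (range (\<alpha> \<circ> x) \<union> range (\<alpha> \<circ> z)) =
      \<alpha> ` (cstar_subalgebra hull (range x \<union> range z))"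
    by (simp add: aut_image_hull[OF \<alpha>] image_Un image_comp)
  also have "\<dots> = UNIV" using aut_bij[OF \<alpha>] by (simp add: gen bij_is_surj)
  finally show ?thesis
    by unfold_locales (simp_all add: adj_x adj_z x_sq z_sq x_comm z_comm xz_comm xz_anti
        aut_one[OF \<alpha>] aut_minus[OF \<alpha>] flip: aut_adj[OF \<alpha>] aut_mult[OF \<alpha>])
qed

section \<open>Involutive gates\<close>

text \<open>For commuting involutions: the identity where \<open>a = 1\<close>, and \<open>b\<close> where \<open>a = -1\<close>.\<close>

definition cz_gate :: "'a::real_algebra_1 \<Rightarrow> 'a \<Rightarrow> 'a" where
  "cz_gate a b = (1/2) *\<^sub>R (1 + a + b - a * b)"

text \<open>Either argument may be read as the control, so one conjugation rule covers an operator
  anticommuting with either of them.\<close>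

lemma cz_gate_sym: "a * b = b * a \<Longrightarrow> cz_gate a b = cz_gate b a"
  by (simp add: cz_gate_def add_ac)

lemma cz_gate_commute:
  assumes "q * a = a * q" "q * b = b * q"
  shows "cz_gate a b * q = q * cz_gate a b"
proof -
  have "a * b * q = q * (a * b)"
    using assms by (metis mult.assoc)
  with assms show ?thesis by (simp add: cz_gate_def algebra_simps)
qed

lemma adj_cz_gate:
  fixes a b :: "'a::cstar_algebra"
  assumes "adj a = a" "adj b = b" "a * b = b * a"
  shows "adj (cz_gate a b) = cz_gate a b"
  using assms by (simp add: cz_gate_def adj_add adj_diff adj_mult)

lemma quarter_sum: "(1/2) *\<^sub>R ((1/2) *\<^sub>R (y + y + y + y)) = (y::'a::real_vector)"
proof -
  have "y + y + y + y = 4 *\<^sub>R y"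
    using scaleR_left_distrib[of 2 2 y] by (simp add: scaleR_2)
  then show ?thesis by simp
qed

lemma cz_gate_square:
  fixes a b :: "'a::real_algebra_1"
  assumes a: "a * a = 1" and b: "b * b = 1" and ab: "a * b = b * a"
  shows "cz_gate a b * cz_gate a b = 1"
proof -
  have 1: "b * (a * y) = a * (b * y)" "a * (a * y) = y" "b * (b * y) = y" for y
    using ab a b by (simp_all flip: mult.assoc)
  have "(1 + a + b - a * b) * (1 + a + b - a * b) = 1 + 1 + 1 + 1"
    by (simp add: algebra_simps 1 a b ab[symmetric])
  then show ?thesis using quarter_sum[of "1::'a"] by (simp add: cz_gate_def)
qed

text \<open>With p and p' the projections (1 + a)/2 and (1 - a)/2, the gate is p + b p'. Moving it
  past q exchanges p and p', and (p' + b p)(p + b p') = b.\<close>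

lemma cz_gate_conj:
  fixes a b :: "'a::real_algebra_1"
  assumes a: "a * a = 1" and b: "b * b = 1" and ab: "a * b = b * a"
    and qa: "a * q = - (q * a)" and qb: "b * q = q * b"
  shows "cz_gate a b * q * cz_gate a b = q * b"
proof -
  have 1: "b * (a * y) = a * (b * y)" "a * (a * y) = y" "b * (b * y) = y" for y
    using ab a b by (simp_all flip: mult.assoc)
  have 2: "a * b * q = - (q * (a * b))"
    by (simp add: mult.assoc qb) (simp add: qa flip: mult.assoc)
  have "(1 + a + b - a * b) * q = q * (1 - a + b + a * b)"
    by (simp add: distrib_left distrib_right left_diff_distrib right_diff_distrib 2 qa qb)
  then have "(1 + a + b - a * b) * q * (1 + a + b - a * b)
      = q * ((1 - a + b + a * b) * (1 + a + b - a * b))" by (simp add: mult.assoc)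
  also have "(1 - a + b + a * b) * (1 + a + b - a * b) = b + b + b + b"
    by (simp add: algebra_simps 1 a b ab[symmetric])
  also have "q * \<dots> = q * b + q * b + q * b + q * b" by (simp add: distrib_left)
  finally show ?thesis using quarter_sum[of "q * b"] by (simp add: cz_gate_def)
qed

definition hadamard :: "'a::real_algebra_1 \<Rightarrow> 'a \<Rightarrow> 'a" where
  "hadamard a b = (1 / sqrt 2) *\<^sub>R (a + b)"

lemma hadamard_square:
  assumes "a * a = 1" "b * b = 1" "a * b = - (b * a)"
  shows "hadamard a b * hadamard a b = (1::'a::real_algebra_1)"
proof -
  have "(a + b) * (a + b) = 2 *\<^sub>R 1"
    using assms by (simp add: distrib_left distrib_right scaleR_2)
  then show ?thesis by (simp add: hadamard_def)
qed

lemma hadamard_conj: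
  fixes a b :: "'a::real_algebra_1"
  assumes "a * a = 1" "b * b = 1" "a * b = - (b * a)"
  shows "hadamard a b * b * hadamard a b = a"
proof -
  have "hadamard a b * b = a * hadamard a b"
    using assms by (simp add: hadamard_def distrib_left distrib_right)
  then have "hadamard a b * b * hadamard a b = a * (hadamard a b * hadamard a b)"
    by (simp add: mult.assoc)
  then show ?thesis by (simp add: hadamard_square assms)
qed

lemma hadamard_commute:
  "a * q = q * a \<Longrightarrow> b * q = q * b \<Longrightarrow> hadamard a b * q = q * hadamard a b"
  by (simp add: hadamard_def algebra_simps)

section \<open>Toric systems\<close>

primrec cumulative :: "(nat \<Rightarrow> 'i set) \<Rightarrow> nat \<Rightarrow> 'i set" where
  "cumulative A 0 = A 0"
| "cumulative A (Suc n) = sym_diff (cumulative A n) (A (Suc n))"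

lemma even_card_sym_diff:
  assumes "finite S" "finite T"
  shows "even (card (sym_diff S T \<inter> R)) \<longleftrightarrow> (even (card (S \<inter> R)) \<longleftrightarrow> even (card (T \<inter> R)))"
proof -
  have "card (S \<inter> R) = card ((S - T) \<inter> R) + card (S \<inter> T \<inter> R)"
    using assms by (subst card_Un_disjoint[symmetric]) (auto intro: arg_cong[where f = card])
  moreover have "card (T \<inter> R) = card ((T - S) \<inter> R) + card (S \<inter> T \<inter> R)"
    using assms by (subst card_Un_disjoint[symmetric]) (auto intro: arg_cong[where f = card])
  moreover have "card (sym_diff S T \<inter> R) = card ((S - T) \<inter> R) + card ((T - S) \<inter> R)"
    using assms by (subst card_Un_disjoint[symmetric]) (auto intro: arg_cong[where f = card])
  ultimately show ?thesis by auto
qed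

lemma finite_cumulative: "(\<And>n. finite (A n)) \<Longrightarrow> finite (cumulative A n)"
  by (induction n) auto

lemma even_card_cumulative:
  assumes "\<And>n. finite (A n)" "\<And>n. even (card (A n \<inter> R))"
  shows "even (card (cumulative A n \<inter> R))"
  by (induction n) (simp_all add: assms even_card_sym_diff finite_cumulative)

text \<open>Telescoping modulo 2: path edge m enters at stage m and cancels at stage m + 1, so only
  the newest one is present.\<close>

lemma cumulative_path:
  assumes "\<And>m n. i m \<in> A n \<longleftrightarrow> m = n \<or> n = Suc m"
  shows "i m \<in> cumulative A n \<longleftrightarrow> m = n"
  by (induction n) (auto simp: assms)

text \<open>Consecutive partial products recover the factors, since their quotient is one factor.
  The spectator set \<open>G\<close> allows stars and faces to be treated separately.\<close>

lemma hull_cumulative_products: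
  fixes f :: "'i \<Rightarrow> 'a::cstar_algebra"
  assumes "commuting_involutions f" "\<And>n. finite (A n)"
  shows "cstar_subalgebra hull (range (\<lambda>n. commuting_prod f (cumulative A n)) \<union> G)
    = cstar_subalgebra hull (range (\<lambda>n. commuting_prod f (A n)) \<union> G)" (is "?H = ?K")
proof
  interpret commuting_involutions f by fact
  note finite = finite_cumulative[of A, OF assms(2)] assms(2)
  have A: "commuting_prod f (A n) \<in> ?K" for n by (rule hull_inc) auto
  have "commuting_prod f (cumulative A n) \<in> ?K" for n
  proof (induction n)
    case (Suc n)
    have "commuting_prod f (cumulative A (Suc n))
        = commuting_prod f (cumulative A n) * commuting_prod f (A (Suc n))"
      using prod_mult[OF finite(1)[of n] finite(2)[of "Suc n"]] by simp
    with Suc A show ?case by (simp add: subalgebra_mult[OF cstar_subalgebra_hull])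
  qed (simp add: A)
  then show "?H \<subseteq> ?K"
    by (intro cstar_subalgebra_hull_minimal cstar_subalgebra_hull) (auto intro: hull_inc)
  have C: "commuting_prod f (cumulative A n) \<in> ?H" for n by (rule hull_inc) auto
  have "commuting_prod f (A n) \<in> ?H" for n
  proof (cases n)
    case 0
    then show ?thesis using C[of 0] by simp
  next
    case (Suc m)
    have "A (Suc m) = sym_diff (cumulative A m) (cumulative A (Suc m))" by auto
    then have "commuting_prod f (A n)
        = commuting_prod f (cumulative A m) * commuting_prod f (cumulative A (Suc m))"
      using prod_mult[OF finite(1)[of m] finite(1)[of "Suc m"]] Suc by metis
    with C show ?thesis by (metis subalgebra_mult[OF cstar_subalgebra_hull])
  qed
  then show "?K \<subseteq> ?H"
    by (intro cstar_subalgebra_hull_minimal cstar_subalgebra_hull) (auto intro: hull_inc)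
qed

text \<open>\<open>Inl m\<close> stands for a_m and \<open>Inr m\<close> for b_m; \<open>A n\<close>
  and \<open>B n\<close> are the supports of the n-th star and face operator. Even intersections
  express that stars and faces commute.\<close>

locale toric_system = pauli_system x z
  for x z :: "nat + nat \<Rightarrow> 'a::cstar_algebra" +
  fixes A B :: "nat \<Rightarrow> (nat + nat) set"
  assumes finite_A: "finite (A n)" and finite_B: "finite (B n)"
    and A_path: "Inl m \<in> A n \<longleftrightarrow> m = n \<or> n = Suc m"
    and B_path: "Inr m \<in> B n \<longleftrightarrow> m = n \<or> n = Suc m"
    and even_inter: "even (card (A n \<inter> B m))"
begin

abbreviation CA where "CA \<equiv> cumulative A"
abbreviation CB where "CB \<equiv> cumulative B"

lemma finite_CA: "finite (CA n)" and finite_CB: "finite (CB n)"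
  by (simp_all add: finite_cumulative finite_A finite_B)

lemma Inl_CA: "Inl m \<in> CA n \<longleftrightarrow> m = n" and Inr_CB: "Inr m \<in> CB n \<longleftrightarrow> m = n"
  by (rule cumulative_path, rule A_path) (rule cumulative_path, rule B_path)

text \<open>The products over \<open>CA n\<close> and \<open>CB m\<close> commute, and they overlap at most in \<open>Inl n\<close> and
  \<open>Inr m\<close>.\<close>

lemma CA_CB_iff: "Inr m \<in> CA n \<longleftrightarrow> Inl n \<in> CB m"
proof -
  have "even (card (CA n \<inter> B k))" for k
    by (intro even_card_cumulative finite_A even_inter)
  then have "even (card (CB m \<inter> CA n))"
    by (intro even_card_cumulative finite_B) (simp add: Int_commute)
  moreover have "CB m \<inter> CA n = (if Inl n \<in> CB m then {Inl n} else {}) \<union> (if Inr m \<in> CA n then {Inr m} else {})"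
  proof (rule set_eqI)
    fix i show "i \<in> CB m \<inter> CA n \<longleftrightarrow>
        i \<in> (if Inl n \<in> CB m then {Inl n} else {}) \<union> (if Inr m \<in> CA n then {Inr m} else {})"
      by (cases i) (auto simp: Inl_CA Inr_CB)
  qed
  ultimately show ?thesis by (auto split: if_splits)
qed

text \<open>The target sites of the n-th gate. They are all of the form \<open>Inr\<close>, while
  controls are of the form \<open>Inl\<close>; this separation makes all gates commute.\<close>

definition tail :: "nat \<Rightarrow> (nat + nat) set" where "tail n = CA n - {Inl n}"

lemma finite_tail: "finite (tail n)"
  by (simp add: tail_def finite_CA)

lemma Inl_tail: "Inl m \<notin> tail n" and Inr_tail: "Inr m \<in> tail n \<longleftrightarrow> Inr m \<in> CA n"
  by (auto simp: tail_def Inl_CA)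

lemma xp_CA: "xp (CA n) = x (Inl n) * xp (tail n)"
  using X.prod_insert[OF finite_tail[of n], of "Inl n"]
  by (simp add: tail_def insert_absorb Inl_CA)

lemma xp_zp_commute: "finite S \<Longrightarrow> finite T \<Longrightarrow> S \<inter> T = {} \<Longrightarrow> xp S * zp T = zp T * xp S"
  by (rule X.prod_commute[symmetric]) (auto intro!: zp_x_commute[symmetric])

lemma xp_xp_commute: "finite S \<Longrightarrow> finite T \<Longrightarrow> xp S * xp T = xp T * xp S"
  by (simp add: X.prod_mult Un_commute)

lemma x_xp_commute: "finite S \<Longrightarrow> x i * xp S = xp S * x i"
  by (rule X.prod_commute) (auto simp: x_comm)

lemma z_zp_commute: "finite S \<Longrightarrow> z i * zp S = zp S * z i"
  by (rule Z.prod_commute) (auto simp: z_comm)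

section \<open>The controlled gates and their limit automorphism\<close>

definition gate :: "nat \<Rightarrow> 'a" where "gate n = cz_gate (z (Inl n)) (xp (tail n))"

lemma gate_factors:
  "z (Inl m) * xp (tail n) = xp (tail n) * z (Inl m)"
  by (rule xp_z_commute[OF finite_tail Inl_tail])

lemma gate_commute:
  "q * z (Inl n) = z (Inl n) * q \<Longrightarrow> q * xp (tail n) = xp (tail n) * q \<Longrightarrow> gate n * q = q * gate n"
  unfolding gate_def by (rule cz_gate_commute)

lemma gate_x_commute: "k \<noteq> n \<Longrightarrow> gate k * x (Inl n) = x (Inl n) * gate k"
  by (rule gate_commute) (auto simp: xz_comm x_xp_commute finite_tail)

lemma gate_z_commute: "Inr j \<notin> CA k \<Longrightarrow> gate k * z (Inr j) = z (Inr j) * gate k"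
  by (rule gate_commute) (auto simp: z_comm xp_z_commute finite_tail Inr_tail)

text \<open>Only gate n moves \<open>x (Inl n)\<close>, and no gate moves \<open>x (Inr n)\<close>
  or \<open>z (Inl n)\<close>. For \<open>z (Inr n)\<close> finiteness comes from
  \<open>CA_CB_iff\<close>: the gates that can move it are indexed by the finite set
  \<open>CB n\<close>.\<close>

sublocale gates: gates gate "range x \<union> range z"
proof
  fix k l
  show "adj (gate k) = gate k"
    unfolding gate_def by (intro adj_cz_gate adj_z adj_xp finite_tail gate_factors)
  show "gate k * gate k = 1"
    unfolding gate_def by (intro cz_gate_square z_sq X.prod_square finite_tail gate_factors)
  have "gate l * z (Inl k) = z (Inl k) * gate l" for k l
    by (rule gate_commute) (auto simp: z_comm gate_factors)
  moreover have "gate l * xp (tail k) = xp (tail k) * gate l" for k l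
    by (rule gate_commute) (auto simp: gate_factors xp_xp_commute finite_tail)
  ultimately show "gate k * gate l = gate l * gate k"
    by (intro gate_commute[of "gate l" k])
next
  fix g assume "g \<in> range x \<union> range z"
  then consider n where "g = x (Inl n)" | n where "g = x (Inr n)" | n where "g = z (Inl n)"
    | n where "g = z (Inr n)" by (auto, metis sum.exhaust, metis sum.exhaust)
  then show "finite {k. gate k * g \<noteq> g * gate k}"
  proof cases
    case 1
    then show ?thesis using gate_x_commute by (auto intro: finite_subset[of _ "{n}"])
  next
    case 2
    then have "gate k * g = g * gate k" for k
      by (intro gate_commute) (auto simp: xz_comm x_xp_commute finite_tail)
    then show ?thesis by simp
  next
    case 3
    then have "gate k * g = g * gate k" for k
      by (intro gate_commute) (auto simp: z_comm gate_factors)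
    then show ?thesis by simp
  next
    case 4
    then have "{k. gate k * g \<noteq> g * gate k} \<subseteq> Inl -` CB n"
      using gate_z_commute[of n] CA_CB_iff[of n] by auto
    then show ?thesis by (rule finite_subset) (auto intro!: finite_vimageI finite_CB)
  qed
qed (rule gen)

lemma gates_x: "gates.limit_aut (x (Inl n)) = xp (CA n)"
proof (rule gates.limit_aut_eqI[of "Suc n"])
  \<comment> \<open>\<open>U N\<close> contains the gates below N, so gate n first acts at stage
    \<open>Suc n\<close>; it attaches the tail, and later gates commute with the result.\<close>
  have "gates.U N * x (Inl n) * gates.U N = (if N \<le> n then x (Inl n) else xp (CA n))" for N
  proof (induction N)
    case (Suc N)
    consider "N < n" | "N = n" | "N > n" by linarith
    then show ?case
    proof cases
      case 1
      with Suc show ?thesis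
        using gates.conj_Suc_commuting[OF gate_x_commute[of N n]] by simp
    next
      case 2
      then have "gates.U (Suc N) * x (Inl n) * gates.U (Suc N) = gate n * x (Inl n) * gate n"
        using Suc by (simp only: gates.conj_Suc) simp
      also have "\<dots> = x (Inl n) * xp (tail n)"
        unfolding gate_def
        by (intro cz_gate_conj z_sq X.prod_square finite_tail gate_factors)
          (auto simp: xz_anti x_xp_commute finite_tail)
      finally show ?thesis using 2 by (simp add: xp_CA)
    next
      case 3
      then have c: "gate N * xp (CA n) = xp (CA n) * gate N"
        by (intro gate_commute)
          (auto simp: xp_xp_commute finite_tail finite_CA xp_z_commute Inl_CA)
      have "gates.U (Suc N) * x (Inl n) * gates.U (Suc N) = gate N * xp (CA n) * gate N"
        using Suc 3 by (simp only: gates.conj_Suc) simp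
      also have "\<dots> = xp (CA n)" by (simp add: c mult.assoc gates.w_sq)
      finally show ?thesis using 3 by simp
    qed
  qed simp
  then show "gates.U N * x (Inl n) * gates.U N = xp (CA n)" if "N \<ge> Suc n" for N
    using that by simp
qed

lemma gates_z: "gates.limit_aut (z (Inr j)) = zp (CB j)"
proof -
  \<comment> \<open>The site j together with the controls, among the first N gates, of those having
    \<open>Inr j\<close> as a target.\<close>
  define Y where "Y N = insert (Inr j) (Inl ` {n. n < N \<and> Inr j \<in> CA n})" for N :: nat
  have fin: "finite (Y N)" for N by (simp add: Y_def)
  have conj: "gates.U N * z (Inr j) * gates.U N = zp (Y N)" for N
  proof (induction N)
    case 0
    then show ?case using Z.prod_insert[of "{}" "Inr j"] by (simp add: Y_def)
  next
    case (Suc N)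
    have step: "gates.U (Suc N) * z (Inr j) * gates.U (Suc N) = gate N * zp (Y N) * gate N"
      by (simp only: gates.conj_Suc Suc)
    show ?case
    proof (cases "Inr j \<in> CA N")
      case True
      have Y: "zp (Y N) = z (Inr j) * zp (Y N - {Inr j})"
        using Z.prod_insert[of "Y N - {Inr j}" "Inr j"] fin by (simp add: Y_def insert_absorb)
      have "xp (tail N) * zp (Y N) = xp (tail N) * z (Inr j) * zp (Y N - {Inr j})"
        by (simp add: Y mult.assoc)
      also have "xp (tail N) * z (Inr j) = - (z (Inr j) * xp (tail N))"
        using xp_z_anti[OF finite_tail, of "Inr j" N] True by (simp add: Inr_tail)
      also have "- (z (Inr j) * xp (tail N)) * zp (Y N - {Inr j})
          = - (z (Inr j) * (xp (tail N) * zp (Y N - {Inr j})))" by (simp add: mult.assoc)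
      also have "xp (tail N) * zp (Y N - {Inr j}) = zp (Y N - {Inr j}) * xp (tail N)"
        using fin by (intro xp_zp_commute finite_tail) (auto simp: Y_def Inl_tail)
      finally have anti: "xp (tail N) * zp (Y N) = - (zp (Y N) * xp (tail N))"
        by (simp add: Y mult.assoc)
      \<comment> \<open>Here the target product is the anticommuting argument, so the roles are
        exchanged: conjugation multiplies \<open>zp (Y N)\<close> by the control
        \<open>z (Inl N)\<close>.\<close>
      have "gate N = cz_gate (xp (tail N)) (z (Inl N))"
        unfolding gate_def by (rule cz_gate_sym[OF gate_factors])
      then have "gate N * zp (Y N) * gate N = zp (Y N) * z (Inl N)"
        by (simp only:) (intro cz_gate_conj X.prod_square finite_tail z_sq
            gate_factors[symmetric] anti z_zp_commute fin)
      also have "\<dots> = z (Inl N) * zp (Y N)" by (rule z_zp_commute[OF fin, symmetric])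
      also have "\<dots> = zp (insert (Inl N) (Y N))"
        using Z.prod_insert[OF fin, of "Inl N" N] by (simp add: Y_def image_iff)
      also have "insert (Inl N) (Y N) = Y (Suc N)"
        using True by (auto simp: Y_def less_Suc_eq)
      finally show ?thesis unfolding step .
    next
      case False
      have "gate N * zp (Y N) = zp (Y N) * gate N"
      proof (rule gate_commute)
        show "zp (Y N) * z (Inl N) = z (Inl N) * zp (Y N)" by (rule z_zp_commute[OF fin, symmetric])
        show "zp (Y N) * xp (tail N) = xp (tail N) * zp (Y N)"
          using False by (intro xp_zp_commute[symmetric] fin finite_tail)
            (auto simp: Y_def Inl_tail Inr_tail)
      qed
      then have "gate N * zp (Y N) * gate N = zp (Y N)"
        by (simp add: mult.assoc gates.w_sq)
      moreover have "Y N = Y (Suc N)" using False by (auto simp: Y_def less_Suc_eq)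
      ultimately show ?thesis unfolding step by simp
    qed
  qed
  have "finite (Inl -` CB j :: nat set)" by (intro finite_vimageI finite_CB) simp
  then obtain M where M: "\<And>n. Inl n \<in> CB j \<Longrightarrow> n < M"
    by (metis finite_nat_set_iff_bounded vimageI)
  show ?thesis
  proof (rule gates.limit_aut_eqI[of M])
    fix N assume "N \<ge> M"
    \<comment> \<open>Beyond M every relevant control has been collected; \<open>CA_CB_iff\<close>
      identifies the controls with the \<open>Inl\<close> part of \<open>CB j\<close>, and j is its
      only \<open>Inr\<close> element.\<close>
    have "Y N = CB j"
    proof (rule set_eqI)
      fix i show "i \<in> Y N \<longleftrightarrow> i \<in> CB j"
        using M \<open>N \<ge> M\<close>
        by (cases i) (auto simp: Y_def CA_CB_iff Inr_CB intro: less_le_trans)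
    qed
    then show "gates.U N * z (Inr j) * gates.U N = zp (CB j)" using conj by simp
  qed
qed

section \<open>The Hadamard gates\<close>

definition had :: "nat \<Rightarrow> 'a" where "had n = hadamard (x (Inl n)) (z (Inl n))"

lemma had_commute:
  "x (Inl n) * q = q * x (Inl n) \<Longrightarrow> z (Inl n) * q = q * z (Inl n) \<Longrightarrow> had n * q = q * had n"
  unfolding had_def by (rule hadamard_commute)

lemma had_x_commute: "i \<noteq> Inl n \<Longrightarrow> had n * x i = x i * had n"
  by (rule had_commute) (auto simp: x_comm xz_comm)

lemma had_z_commute: "i \<noteq> Inl n \<Longrightarrow> had n * z i = z i * had n"
  by (rule had_commute) (auto simp: z_comm xz_comm)

sublocale hads: gates had "range x \<union> range z"
proof
  fix k l
  show "adj (had k) = had k" by (simp add: had_def hadamard_def adj_add adj_x adj_z)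
  show "had k * had k = 1" unfolding had_def by (intro hadamard_square x_sq z_sq xz_anti)
  show "had k * had l = had l * had k"
  proof (cases "k = l")
    case False
    then show ?thesis by (intro had_commute) (simp_all add: had_x_commute had_z_commute)
  qed simp
next
  fix g assume "g \<in> range x \<union> range z"
  then obtain i where "g = x i \<or> g = z i" by auto
  then have "{k. had k * g \<noteq> g * had k} \<subseteq> Inl -` {i}"
    using had_x_commute[of i] had_z_commute[of i] by (intro subsetI) (auto, metis+)
  then show "finite {k. had k * g \<noteq> g * had k}"
    by (rule finite_subset) (auto intro!: finite_vimageI)
qed (rule gen)

lemma hads_z_Inr: "hads.limit_aut (z (Inr j)) = z (Inr j)"
proof (rule hads.limit_aut_eqI)
  show "hads.U N * z (Inr j) * hads.U N = z (Inr j)" for N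
  proof (induction N)
    case (Suc N)
    then show ?case using hads.conj_Suc_commuting[OF had_z_commute[of "Inr j" N]] by simp
  qed simp
qed

lemma hads_z_Inl: "hads.limit_aut (z (Inl n)) = x (Inl n)"
proof (rule hads.limit_aut_eqI[of "Suc n"])
  have "hads.U N * z (Inl n) * hads.U N = (if N \<le> n then z (Inl n) else x (Inl n))" for N
  proof (induction N)
    case (Suc N)
    consider "N < n" | "N = n" | "N > n" by linarith
    then show ?case
    proof cases
      case 1
      with Suc show ?thesis
        using hads.conj_Suc_commuting[OF had_z_commute[of "Inl n" N]] by simp
    next
      case 2
      then have "hads.U (Suc N) * z (Inl n) * hads.U (Suc N) = had n * z (Inl n) * had n"
        using Suc by (simp only: hads.conj_Suc) simp
      also have "\<dots> = x (Inl n)"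
        unfolding had_def by (intro hadamard_conj x_sq z_sq xz_anti)
      finally show ?thesis using 2 by simp
    next
      case 3
      with Suc show ?thesis
        using hads.conj_Suc_commuting[OF had_z_commute[of "Inl n" N]] by simp
    qed
  qed simp
  then show "hads.U N * z (Inl n) * hads.U N = x (Inl n)" if "N \<ge> Suc n" for N
    using that by simp
qed

text \<open>The Hadamard gates act first: the controlled gates fix \<open>z (Inl n)\<close> but
  attach the tail to \<open>x (Inl n)\<close>.\<close>

definition toric_aut :: "'a \<Rightarrow> 'a" where "toric_aut = gates.limit_aut \<circ> hads.limit_aut"

lemma toric_aut: "isometric_automorphism toric_aut"
  unfolding toric_aut_def
  by (intro isometric_automorphism_comp gates.isometric_automorphism_limit_aut
      hads.isometric_automorphism_limit_aut)

lemma toric_aut_z: "toric_aut (z i) = (case i of Inl n \<Rightarrow> xp (CA n) | Inr j \<Rightarrow> zp (CB j))"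
  by (cases i) (simp_all add: toric_aut_def hads_z_Inl hads_z_Inr gates_x gates_z)

lemma toric_aut_diag:
  "toric_aut ` diag = cstar_subalgebra hull (range (\<lambda>n. xp (A n)) \<union> range (\<lambda>n. zp (B n)))"
proof -
  have "range (toric_aut \<circ> z) = range (\<lambda>n. xp (CA n)) \<union> range (\<lambda>n. zp (CB n))"
  proof (intro equalityI subsetI)
    fix y assume "y \<in> range (toric_aut \<circ> z)"
    then obtain i where "y = toric_aut (z i)" by auto
    then show "y \<in> range (\<lambda>n. xp (CA n)) \<union> range (\<lambda>n. zp (CB n))"
      by (cases i) (simp_all add: toric_aut_z)
  next
    fix y assume "y \<in> range (\<lambda>n. xp (CA n)) \<union> range (\<lambda>n. zp (CB n))"
    then consider n where "y = toric_aut (z (Inl n))" | n where "y = toric_aut (z (Inr n))"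
      by (auto simp: toric_aut_z)
    then show "y \<in> range (toric_aut \<circ> z)" by cases auto
  qed
  then have "toric_aut ` diag = cstar_subalgebra hull (range (\<lambda>n. xp (CA n)) \<union> range (\<lambda>n. zp (CB n)))"
    by (simp add: diag_def aut_image_hull[OF toric_aut] image_comp)
  also have "\<dots> = cstar_subalgebra hull (range (\<lambda>n. zp (CB n)) \<union> range (\<lambda>n. xp (A n)))"
    by (subst hull_cumulative_products)
      (simp_all add: X.commuting_involutions_axioms finite_A Un_commute)
  also have "\<dots> = cstar_subalgebra hull (range (\<lambda>n. zp (B n)) \<union> range (\<lambda>n. xp (A n)))"
    by (rule hull_cumulative_products) (simp_all add: Z.commuting_involutions_axioms finite_B)
  finally show ?thesis by (simp add: Un_commute)
qed

text \<open>\<open>C\<close> is the diagonal of the image Pauli system, so the abstract theorem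
  applies to it; the inverse of \<open>toric_aut\<close> carries it back to
  \<open>diag\<close>.\<close>

theorem toric_equivalence:
  defines "C \<equiv> cstar_subalgebra hull (range (\<lambda>n. xp (A n)) \<union> range (\<lambda>n. zp (B n)))"
  shows "cstar_diagonal C" "automorphism_equivalent C diag"
proof -
  interpret image: pauli_system "toric_aut \<circ> x" "toric_aut \<circ> z"
    by (intro pauli_system_image toric_aut pauli_system_axioms)
  have "image.diag = toric_aut ` diag"
    by (simp add: diag_def image.diag_def aut_image_hull[OF toric_aut] image_comp)
  also have "\<dots> = C" unfolding C_def by (rule toric_aut_diag)
  finally show "cstar_diagonal C" using image.cstar_diagonal_diag by simp
  let ?\<beta> = "inv toric_aut"
  have \<beta>: "isometric_automorphism ?\<beta>" by (rule isometric_automorphism_inv[OF toric_aut])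
  have "?\<beta> ` C = diag"
    unfolding C_def toric_aut_diag[symmetric]
    using aut_bij[OF toric_aut] by (simp add: image_inv_f_f bij_is_inj)
  then have "star_iso C diag ?\<beta>"
    using \<beta> unfolding isometric_automorphism_def star_iso_def
    by (auto intro: bij_betw_subset[of _ UNIV UNIV])
  then show "automorphism_equivalent C diag"
    using \<beta> unfolding automorphism_equivalent_def isometric_automorphism_def by blast
qed

end

section \<open>The Pauli operators of the quasi-local algebra\<close>

lemma pure_tensor_cong:
  "(\<And>e. e \<in> \<Lambda> \<Longrightarrow> a e = b e) \<Longrightarrow> pure_tensor \<Lambda> a = pure_tensor \<Lambda> b"
  by (auto simp: pure_tensor_def fun_eq_iff intro!: prod.cong)

lemma finite_configs: "finite \<Lambda> \<Longrightarrow> finite (configs \<Lambda>)"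
  by (simp add: configs_def finite_PiE)

text \<open>Matrix units of the local algebra are pure tensors of matrix units; this reduces
  generation to pure tensors.\<close>

lemma pure_tensor_unit:
  assumes "finite \<Lambda>" "p \<in> configs \<Lambda>" "q \<in> configs \<Lambda>"
  shows "pure_tensor \<Lambda> (\<lambda>e. \<chi> i j. if i = p e \<and> j = q e then 1 else 0) s t
    = (if s = p \<and> t = q then 1 else 0)"
proof (cases "s \<in> configs \<Lambda> \<and> t \<in> configs \<Lambda>")
  case True
  have "s = p \<and> t = q \<longleftrightarrow> (\<forall>e\<in>\<Lambda>. s e = p e \<and> t e = q e)"
    using True assms(2,3) unfolding configs_def by (metis PiE_ext)
  moreover have "(\<Prod>e\<in>\<Lambda>. if s e = p e \<and> t e = q e then 1 else 0 :: complex)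
      = (if \<forall>e\<in>\<Lambda>. s e = p e \<and> t e = q e then 1 else 0)"
    using assms(1) by (auto simp: prod_zero_iff intro!: prod.neutral)
  ultimately show ?thesis using True by (simp add: pure_tensor_def)
next
  case False
  with assms show ?thesis by (auto simp: pure_tensor_def)
qed

context quasi_local_algebra
begin

definition site :: "edge \<Rightarrow> complex^2^2 \<Rightarrow> 'a" where
  "site e M = \<iota> {e} (pure_tensor {e} (\<lambda>_. M))"

lemma iota_pure_tensor_mult:
  assumes "finite \<Lambda>" "\<Lambda> \<subseteq> lattice_edges"
  shows "\<iota> \<Lambda> (pure_tensor \<Lambda> a) * \<iota> \<Lambda> (pure_tensor \<Lambda> b) = \<iota> \<Lambda> (pure_tensor \<Lambda> (\<lambda>e. a e ** b e))"
  using iota_mult[OF assms pure_tensor_in_local_alg pure_tensor_in_local_alg]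
    local_mult_pure_tensor[OF assms(1)] by metis

lemma iota_pure_tensor_extend:
  assumes "finite \<Lambda>" "\<Lambda> \<subseteq> lattice_edges" "\<Lambda>' \<subseteq> \<Lambda>"
  shows "\<iota> \<Lambda>' (pure_tensor \<Lambda>' a) = \<iota> \<Lambda> (pure_tensor \<Lambda> (\<lambda>e. if e \<in> \<Lambda>' then a e else mat 1))"
  using iota_inclusion[OF assms pure_tensor_in_local_alg] inclusion_pure_tensor[OF assms(1,3)] by metis

lemma site_mult: "e \<in> lattice_edges \<Longrightarrow> site e M * site e N = site e (M ** N)"
  unfolding site_def by (rule iota_pure_tensor_mult) auto

lemma site_one: "e \<in> lattice_edges \<Longrightarrow> site e (mat 1) = 1"
  using iota_one[of "{e}"] by (simp add: site_def local_one_def)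

text \<open>Inside the algebra of both edges, one of the two factors is the identity at each
  site.\<close>

lemma site_commute:
  assumes "e \<in> lattice_edges" "f \<in> lattice_edges" "e \<noteq> f"
  shows "site e M * site f N = site f N * site e M"
proof -
  let ?L = "{e, f}"
  let ?a = "\<lambda>g. if g \<in> {e} then M else mat 1" and ?b = "\<lambda>g. if g \<in> {f} then N else mat 1"
  have L: "finite ?L" "?L \<subseteq> lattice_edges" using assms by auto
  have e: "site e M = \<iota> ?L (pure_tensor ?L ?a)" and f: "site f N = \<iota> ?L (pure_tensor ?L ?b)"
    unfolding site_def by (rule iota_pure_tensor_extend[OF L]; simp)+
  have "pure_tensor ?L (\<lambda>g. ?a g ** ?b g) = pure_tensor ?L (\<lambda>g. ?b g ** ?a g)"
    using assms(3) by (intro pure_tensor_cong) auto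
  then show ?thesis by (simp only: e f iota_pure_tensor_mult[OF L])
qed

lemma site_add: "e \<in> lattice_edges \<Longrightarrow> site e (M + N) = site e M + site e N"
proof -
  assume "e \<in> lattice_edges"
  then have "\<iota> {e} (local_add (pure_tensor {e} (\<lambda>_. M)) (pure_tensor {e} (\<lambda>_. N))) = site e M + site e N"
    unfolding site_def by (intro iota_add pure_tensor_in_local_alg) auto
  moreover have "local_add (pure_tensor {e} (\<lambda>_. M)) (pure_tensor {e} (\<lambda>_. N)) = pure_tensor {e} (\<lambda>_. M + N)"
    by (auto simp: local_add_def pure_tensor_def fun_eq_iff)
  ultimately show ?thesis by (simp add: site_def)
qed

lemma site_scale: "e \<in> lattice_edges \<Longrightarrow> site e (\<chi> i j. c * M $ i $ j) = c *\<^sub>C site e M"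
proof -
  assume "e \<in> lattice_edges"
  then have "\<iota> {e} (local_scale c (pure_tensor {e} (\<lambda>_. M))) = c *\<^sub>C site e M"
    unfolding site_def by (intro iota_scale pure_tensor_in_local_alg) auto
  moreover have "local_scale c (pure_tensor {e} (\<lambda>_. M)) = pure_tensor {e} (\<lambda>_. \<chi> i j. c * M $ i $ j)"
    by (auto simp: local_scale_def pure_tensor_def fun_eq_iff)
  ultimately show ?thesis by (simp add: site_def)
qed

lemma site_adj: "e \<in> lattice_edges \<Longrightarrow> adj (site e M) = site e (\<chi> i j. cnj (M $ j $ i))"
proof -
  assume "e \<in> lattice_edges"
  then have "\<iota> {e} (local_adj (pure_tensor {e} (\<lambda>_. M))) = adj (site e M)"
    unfolding site_def by (intro iota_adj pure_tensor_in_local_alg) auto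
  moreover have "local_adj (pure_tensor {e} (\<lambda>_. M)) = pure_tensor {e} (\<lambda>_. \<chi> i j. cnj (M $ j $ i))"
    by (auto simp: local_adj_def pure_tensor_def fun_eq_iff)
  ultimately show ?thesis by (simp add: site_def)
qed

lemma sigma_site: "sigma_x \<iota> e = site e pauli_x" "sigma_z \<iota> e = site e pauli_z"
  by (simp_all add: sigma_x_def sigma_z_def site_def)

lemmas matrix_simps = vec_eq_iff forall_2 matrix_matrix_mult_def sum_2 pauli_x_def pauli_z_def mat_def

lemma sigma_adj:
  assumes "e \<in> lattice_edges"
  shows "adj (sigma_x \<iota> e) = sigma_x \<iota> e" "adj (sigma_z \<iota> e) = sigma_z \<iota> e"
  unfolding sigma_site site_adj[OF assms] by (rule arg_cong[of _ _ "site e"]; simp add: matrix_simps)+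

lemma sigma_square:
  assumes "e \<in> lattice_edges"
  shows "sigma_x \<iota> e * sigma_x \<iota> e = 1" "sigma_z \<iota> e * sigma_z \<iota> e = 1"
  unfolding sigma_site site_mult[OF assms] site_one[OF assms, symmetric]
  by (rule arg_cong[of _ _ "site e"]; simp add: matrix_simps)+

lemma sigma_anticommute:
  assumes "e \<in> lattice_edges"
  shows "sigma_x \<iota> e * sigma_z \<iota> e = - (sigma_z \<iota> e * sigma_x \<iota> e)"
proof -
  have "pauli_x ** pauli_z = (\<chi> i j. (-1) * (pauli_z ** pauli_x) $ i $ j)"
    by (simp add: matrix_simps)
  then show ?thesis
    unfolding sigma_site site_mult[OF assms] using site_scale[OF assms, of "-1"] by simp
qed

section \<open>The Pauli operators generate the quasi-local algebra\<close>

definition sigma_algebra :: "'a set" where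
  "sigma_algebra = cstar_subalgebra hull (sigma_x \<iota> ` lattice_edges \<union> sigma_z \<iota> ` lattice_edges)"

lemma subalgebra_sigma: "cstar_subalgebra sigma_algebra"
  unfolding sigma_algebra_def by (rule cstar_subalgebra_hull)

lemma sigma_in: "e \<in> lattice_edges \<Longrightarrow> sigma_x \<iota> e \<in> sigma_algebra"
  "e \<in> lattice_edges \<Longrightarrow> sigma_z \<iota> e \<in> sigma_algebra"
  unfolding sigma_algebra_def by (auto intro: hull_inc)

lemma one_in_sigma: "1 \<in> sigma_algebra"
proof -
  \<comment> \<open>\<open>cstar_subalgebra\<close> does not demand a unit; it is obtained as the
    square of a Pauli operator at an arbitrary edge.\<close>
  have e: "{(0, 0), (1, 0)} \<in> lattice_edges" by (force simp: lattice_edges_def)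
  show ?thesis
    using subalgebra_mult[OF subalgebra_sigma sigma_in(1)[OF e] sigma_in(1)[OF e]] sigma_square(1)[OF e]
    by simp
qed

lemma site_in:
  assumes e: "e \<in> lattice_edges"
  shows "site e M \<in> sigma_algebra"
proof -
  let ?s = "\<lambda>c N. (\<chi> i j. c * N $ i $ j) :: complex^2^2"
  \<comment> \<open>Coordinates of M in the basis 1, X, Z, XZ, where XZ has rows (0, -1) and (1,
    0).\<close>
  let ?a = "(M$1$1 + M$2$2) / 2" and ?b = "(M$2$1 + M$1$2) / 2"
    and ?c = "(M$1$1 - M$2$2) / 2" and ?d = "(M$2$1 - M$1$2) / 2"
  have "M = ?s ?a (mat 1) + ?s ?b pauli_x + ?s ?c pauli_z + ?s ?d (pauli_x ** pauli_z)"
    by (simp add: matrix_simps field_simps)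
  then have "site e M = site e (?s ?a (mat 1) + ?s ?b pauli_x + ?s ?c pauli_z + ?s ?d (pauli_x ** pauli_z))"
    by (rule arg_cong)
  also have "\<dots> = ?a *\<^sub>C 1 + ?b *\<^sub>C sigma_x \<iota> e + ?c *\<^sub>C sigma_z \<iota> e + ?d *\<^sub>C (sigma_x \<iota> e * sigma_z \<iota> e)"
    by (simp only: site_add[OF e] site_scale[OF e] site_one[OF e] sigma_site site_mult[OF e])
  also have "\<dots> \<in> sigma_algebra"
    by (intro subalgebra_add[OF subalgebra_sigma] subalgebra_scaleC[OF subalgebra_sigma]
        subalgebra_mult[OF subalgebra_sigma] one_in_sigma sigma_in e)
  finally show ?thesis .
qed

lemma pure_tensor_in:
  "finite \<Lambda> \<Longrightarrow> \<Lambda> \<subseteq> lattice_edges \<Longrightarrow> \<iota> \<Lambda> (pure_tensor \<Lambda> a) \<in> sigma_algebra"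
proof (induction \<Lambda> rule: finite_induct)
  case empty
  have "pure_tensor {} a = local_one {}"
    unfolding local_one_def by (rule pure_tensor_cong) simp
  then show ?case using iota_one[of "{}"] one_in_sigma by simp
next
  case (insert e \<Lambda>)
  let ?L = "insert e \<Lambda>"
  let ?a = "\<lambda>f. if f \<in> {e} then a f else mat 1" and ?b = "\<lambda>f. if f \<in> \<Lambda> then a f else mat 1"
  have L: "finite ?L" "?L \<subseteq> lattice_edges" using insert by auto
  have "pure_tensor ?L a = pure_tensor ?L (\<lambda>f. ?a f ** ?b f)"
    using insert.hyps by (intro pure_tensor_cong) auto
  then have "\<iota> ?L (pure_tensor ?L a) = \<iota> ?L (pure_tensor ?L ?a) * \<iota> ?L (pure_tensor ?L ?b)"
    by (simp only: iota_pure_tensor_mult[OF L])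
  also have "\<iota> ?L (pure_tensor ?L ?a) = \<iota> {e} (pure_tensor {e} a)"
    by (rule iota_pure_tensor_extend[OF L, symmetric]) simp
  also have "pure_tensor {e} a = pure_tensor {e} (\<lambda>_. a e)"
    by (rule pure_tensor_cong) simp
  also have "\<iota> ?L (pure_tensor ?L ?b) = \<iota> \<Lambda> (pure_tensor \<Lambda> a)"
    by (rule iota_pure_tensor_extend[OF L, symmetric]) auto
  finally have "\<iota> ?L (pure_tensor ?L a) = site e (a e) * \<iota> \<Lambda> (pure_tensor \<Lambda> a)"
    by (simp only: site_def)
  then show ?case
    using insert by (auto intro!: subalgebra_mult[OF subalgebra_sigma] site_in)
qed

lemma local_alg_in:
  assumes L: "finite \<Lambda>" "\<Lambda> \<subseteq> lattice_edges" and m: "m \<in> local_alg \<Lambda>"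
  shows "\<iota> \<Lambda> m \<in> sigma_algebra"
proof -
  \<comment> \<open>The matrix m cut down to the entries in F; the induction adds one matrix unit at
    a time.\<close>
  let ?m = "\<lambda>F s t. if (s, t) \<in> F then m s t else 0"
  have m_alg: "?m F \<in> local_alg \<Lambda>" for F using m by (auto simp: local_alg_def)
  have "\<iota> \<Lambda> (?m F) \<in> sigma_algebra" if "finite F" "F \<subseteq> configs \<Lambda> \<times> configs \<Lambda>" for F
    using that
  proof (induction F rule: finite_induct)
    case empty
    have "\<iota> \<Lambda> (local_scale 0 m) = 0" using iota_scale[OF L m, of 0] by simp
    then show ?case by (simp add: local_scale_def subalgebra_zero[OF subalgebra_sigma])
  next
    case (insert pq F)
    obtain p q where pq: "pq = (p, q)" by (cases pq)
    let ?u = "pure_tensor \<Lambda> (\<lambda>e. \<chi> i j. if i = p e \<and> j = q e then 1 else 0)"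
    have p: "p \<in> configs \<Lambda>" "q \<in> configs \<Lambda>" using insert.prems pq by auto
    have u: "local_scale (m p q) ?u \<in> local_alg \<Lambda>"
      using pure_tensor_in_local_alg[of \<Lambda>] unfolding local_alg_def local_scale_def by fastforce
    have "?m (insert pq F) = local_add (local_scale (m p q) ?u) (?m F)"
    proof (intro ext)
      fix s t
      show "?m (insert pq F) s t = local_add (local_scale (m p q) ?u) (?m F) s t"
        using insert.hyps pq
        by (auto simp: local_add_def local_scale_def pure_tensor_unit[OF L(1) p])
    qed
    then have "\<iota> \<Lambda> (?m (insert pq F)) = m p q *\<^sub>C \<iota> \<Lambda> ?u + \<iota> \<Lambda> (?m F)"
      by (simp only: iota_add[OF L u m_alg] iota_scale[OF L pure_tensor_in_local_alg])
    also have "\<dots> \<in> sigma_algebra"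
      using insert by (intro subalgebra_add[OF subalgebra_sigma] subalgebra_scaleC[OF subalgebra_sigma]
          pure_tensor_in L) auto
    finally show ?case .
  qed
  from this[of "configs \<Lambda> \<times> configs \<Lambda>"] have "\<iota> \<Lambda> (?m (configs \<Lambda> \<times> configs \<Lambda>)) \<in> sigma_algebra"
    using finite_configs[OF L(1)] by simp
  moreover have "?m (configs \<Lambda> \<times> configs \<Lambda>) = m"
    using m by (auto simp: fun_eq_iff local_alg_def)
  ultimately show ?thesis by simp
qed

lemma sigma_generate: "sigma_algebra = UNIV"
proof -
  have "(\<Union>\<Lambda>\<in>{\<Lambda>. finite \<Lambda> \<and> \<Lambda> \<subseteq> lattice_edges}. \<iota> \<Lambda> ` local_alg \<Lambda>) \<subseteq> sigma_algebra"
    by (auto intro: local_alg_in)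
  from closure_minimal[OF this subalgebra_closed[OF subalgebra_sigma]] iota_dense
  show ?thesis by auto
qed

lemma pauli_system_sigma:
  fixes ed :: "'i::countable \<Rightarrow> edge"
  assumes ed: "bij_betw ed UNIV lattice_edges"
  shows "pauli_system (sigma_x \<iota> \<circ> ed) (sigma_z \<iota> \<circ> ed)"
proof -
  have e: "ed i \<in> lattice_edges" for i using ed by (auto simp: bij_betw_def)
  have ne: "ed i \<noteq> ed j" if "i \<noteq> j" for i j using ed that by (auto simp: bij_betw_def inj_on_def)
  have "range (f \<circ> ed) = f ` lattice_edges" for f :: "edge \<Rightarrow> 'a"
    using ed unfolding bij_betw_def image_comp[symmetric] by simp
  then have "cstar_subalgebra hull (range (sigma_x \<iota> \<circ> ed) \<union> range (sigma_z \<iota> \<circ> ed)) = sigma_algebra"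
    by (simp only: sigma_algebra_def)
  then have gen: "cstar_subalgebra hull (range (sigma_x \<iota> \<circ> ed) \<union> range (sigma_z \<iota> \<circ> ed)) = UNIV"
    by (simp only: sigma_generate)
  have comm: "site (ed i) M * site (ed j) M = site (ed j) M * site (ed i) M" for i j M
    using site_commute[OF e e ne] by (cases "i = j") simp_all
  show ?thesis
  proof
    show "(sigma_x \<iota> \<circ> ed) i * (sigma_x \<iota> \<circ> ed) j = (sigma_x \<iota> \<circ> ed) j * (sigma_x \<iota> \<circ> ed) i"
      "(sigma_z \<iota> \<circ> ed) i * (sigma_z \<iota> \<circ> ed) j = (sigma_z \<iota> \<circ> ed) j * (sigma_z \<iota> \<circ> ed) i" for i j
      by (simp_all only: o_apply sigma_site comm)
    show "(sigma_x \<iota> \<circ> ed) i * (sigma_z \<iota> \<circ> ed) j = (sigma_z \<iota> \<circ> ed) j * (sigma_x \<iota> \<circ> ed) i"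
      if "i \<noteq> j" for i j
      by (simp only: o_apply sigma_site site_commute[OF e e ne[OF that]])
  qed (simp_all only: o_apply sigma_adj[OF e] sigma_square[OF e] sigma_anticommute[OF e] gen)
qed

end

text \<open>The type \<open>edge\<close> contains arbitrary vertex sets, and commutation of the
  Pauli operators is known only at lattice edges. The fold is therefore taken relative to the range
  of the enumeration.\<close>

lemma commuting_prod_reindex:
  fixes f :: "'i \<Rightarrow> 'a::monoid_mult"
  assumes "inj g" "commuting_family (f \<circ> g)" "finite S"
  shows "commuting_prod f (g ` S) = commuting_prod (f \<circ> g) S"
proof -
  interpret commuting_family "f \<circ> g" by fact
  have "comp_fun_commute_on (range g) (\<lambda>i a. f i * a)"
  proof
    fix i j assume "i \<in> range g" "j \<in> range g"
    then have "f i * (f j * a) = f j * (f i * a)" for a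
      using commute by (auto simp flip: mult.assoc)
    then show "(\<lambda>a. f j * a) \<circ> (\<lambda>a. f i * a) = (\<lambda>a. f i * a) \<circ> (\<lambda>a. f j * a)"
      by (simp add: fun_eq_iff)
  qed
  note fold_insert = comp_fun_commute_on.fold_insert[OF this]
  show ?thesis
    using assms(3)
  proof (induction S)
    case (insert i S)
    have "commuting_prod f (insert (g i) (g ` S)) = f (g i) * commuting_prod f (g ` S)"
      unfolding commuting_prod_def
      by (rule fold_insert) (use insert.hyps assms(1) in \<open>auto dest: injD\<close>)
    also have "\<dots> = commuting_prod (f \<circ> g) (insert i S)"
      using prod_insert[OF insert.hyps] insert.IH by (simp add: comp_def)
    finally show ?case by (simp only: image_insert)
  qed simp
qed

section \<open>The spiral\<close>

text \<open>One step of an anticlockwise square spiral from the origin; the branches are the bottom,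
  right, top and left arms.\<close>

fun step :: "vertex \<Rightarrow> vertex" where
  "step (x, y) =
    (if y \<le> 0 \<and> y \<le> x \<and> x \<le> - y then (x + 1, y)
     else if - x < y \<and> y < x then (x, y + 1)
     else if - y < x \<and> x \<le> y then (x - 1, y)
     else (x, y - 1))"

definition spiral :: "nat \<Rightarrow> vertex" where "spiral n = (step ^^ n) (0, 0)"

text \<open>The position of a vertex along the spiral: the ring of radius k ends at the corner (k,
  -k), with rank (2k + 1)^2 - 1. It yields injectivity of \<open>spiral\<close>, and surjectivity by
  descent along predecessors.\<close>

fun rank :: "vertex \<Rightarrow> int" where
  "rank (x, y) =
    (if y \<le> 0 \<and> y \<le> x \<and> x \<le> - y then 4 * (y * y) - 3 * y + x
     else if - x < y \<and> y < x then 4 * (x * x) - 3 * x + y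
     else if - y < x \<and> x \<le> y then 4 * (y * y) - y - x
     else 4 * (x * x) - x - y)"

lemma rank_step: "rank (step v) = rank v + 1"
proof (cases v)
  case (Pair x y)
  \<comment> \<open>Each arm is split according to whether the step stays on it or turns into the
    next arm.\<close>
  consider "y \<le> 0" "y \<le> x" "x < - y" | "y \<le> 0" "x = - y" | "- x < y" "y < x - 1" | "- x < y" "y = x - 1"
    | "- y < x - 1" "x \<le> y" | "x = 1 - y" "x \<le> y" | "x < y - 1" "y \<le> - x" | "x = y - 1" "y \<le> - x"
    by linarith
  then show ?thesis
  proof cases
    case 6
    then show ?thesis unfolding Pair \<open>x = 1 - y\<close> by (simp add: algebra_simps)
  qed (auto simp: Pair algebra_simps)
qed

lemma rank_nonneg: "rank v \<ge> 0"
proof (cases v)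
  case (Pair x y)
  have square: "k \<le> k * k" for k :: int
    by (cases "k \<ge> 1") (use mult_right_mono[of 1 k k] zero_le_square[of k] in linarith)+
  show ?thesis
    unfolding Pair rank.simps
    using square[of x] square[of y] zero_le_square[of x] zero_le_square[of y] by (smt (verit))
qed

lemma exists_pred:
  assumes "v \<noteq> (0, 0)"
  shows "\<exists>w. step w = v"
proof (cases v)
  case (Pair x y)
  \<comment> \<open>The images of the four arms under \<open>step\<close>; they miss only the
    origin.\<close>
  with assms consider "y \<le> 0 \<and> y < x \<and> x \<le> 1 - y" | "1 - x < y \<and> y \<le> x" | "- y \<le> x \<and> x < y"
    | "x \<le> y \<and> y < - x" by fastforce
  then show ?thesis
  proof cases
    case 1 then show ?thesis using Pair by (intro exI[of _ "(x - 1, y)"]) auto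
  next
    case 2 then show ?thesis using Pair by (intro exI[of _ "(x, y - 1)"]) auto
  next
    case 3 then show ?thesis using Pair by (intro exI[of _ "(x + 1, y)"]) auto
  next
    case 4 then show ?thesis using Pair by (intro exI[of _ "(x, y + 1)"]) auto
  qed
qed

lemma spiral_Suc: "spiral (Suc n) = step (spiral n)"
  by (simp add: spiral_def)

lemma rank_spiral: "rank (spiral n) = int n"
  by (induction n) (simp_all add: spiral_Suc rank_step, simp add: spiral_def)

lemma inj_spiral: "inj spiral"
  by (rule injI) (metis rank_spiral of_nat_eq_iff)

lemma surj_spiral: "\<exists>n. spiral n = v"
proof (induction "nat (rank v)" arbitrary: v rule: less_induct)
  case less
  show ?case
  proof (cases "v = (0, 0)")
    case True
    then show ?thesis by (intro exI[of _ 0]) (simp add: spiral_def)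
  next
    case False
    then obtain w where w: "step w = v" using exists_pred by blast
    then have "nat (rank w) < nat (rank v)" using rank_step[of w] rank_nonneg[of w] by auto
    then obtain n where "spiral n = w" using less by blast
    with w show ?thesis by (metis spiral_Suc)
  qed
qed

text \<open>The rotation by 180 degrees about \<open>(1/4, 1/4)\<close> maps \<open>v\<close> to the centre of the face \<open>- v\<close>.
  It sends an edge to a dual edge; \<open>dual_edge v w\<close> is the lattice edge crossing the image of
  \<open>{v, w}\<close>.\<close>

fun dual_edge :: "vertex \<Rightarrow> vertex \<Rightarrow> edge" where
  "dual_edge (x, y) (x', y') =
    (if y = y' then {(- min x x', - y), (- min x x', 1 - y)}
     else {(- x, - min y y'), (1 - x, - min y y')})"

definition primal :: "nat \<Rightarrow> edge" where "primal n = {spiral n, spiral (Suc n)}"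
definition dual :: "nat \<Rightarrow> edge" where "dual n = dual_edge (spiral n) (spiral (Suc n))"

fun step_h :: "int \<Rightarrow> int \<Rightarrow> bool" where
  "step_h x y \<longleftrightarrow> step (x, y) = (x + 1, y) \<or> step (x + 1, y) = (x, y)"
fun step_v :: "int \<Rightarrow> int \<Rightarrow> bool" where
  "step_v x y \<longleftrightarrow> step (x, y) = (x, y + 1) \<or> step (x, y + 1) = (x, y)"

text \<open>Horizontal steps fill the upper and lower sectors between the diagonals, vertical steps
  the left and right ones, and the boundary conventions of \<open>step\<close> fit exactly after
  negation. By \<open>primal_h\<close> and \<open>dual_h\<close> this is the partition of the
  edges.\<close>

lemma step_complementary: "step_h x y \<longleftrightarrow> \<not> step_v (- x) (- y)"
  by (auto split: if_splits)

lemma step_cases: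
  obtains x y where "v = (x, y)" "step v = (x + 1, y)" | x y where "v = (x, y)" "step v = (x, y + 1)"
    | x y where "v = (x, y)" "step v = (x - 1, y)" | x y where "v = (x, y)" "step v = (x, y - 1)"
proof (cases v)
  case (Pair x y)
  then have "step v = (x + 1, y) \<or> step v = (x, y + 1) \<or> step v = (x - 1, y) \<or> step v = (x, y - 1)"
    by simp
  with that Pair show thesis by blast
qed

declare step.simps [simp del]

lemma ex_spiral: "(\<exists>n. P (spiral n)) \<longleftrightarrow> (\<exists>v. P v)"
  using surj_spiral by metis

lemma primal_iff: "{p, q} \<in> range primal \<longleftrightarrow> step p = q \<or> step q = p"
proof -
  have "{p, q} \<in> range primal \<longleftrightarrow> (\<exists>v. {p, q} = {v, step v})"
    unfolding ex_spiral[symmetric] by (auto simp: primal_def spiral_Suc)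
  then show ?thesis unfolding doubleton_eq_iff by metis
qed

lemma dual_iff: "e \<in> range dual \<longleftrightarrow> (\<exists>v. e = dual_edge v (step v))"
  unfolding ex_spiral[symmetric] by (auto simp: dual_def spiral_Suc)

lemma primal_h: "{(x, y), (x + 1, y)} \<in> range primal \<longleftrightarrow> step_h x y"
  by (simp add: primal_iff)

lemma primal_v: "{(x, y), (x, y + 1)} \<in> range primal \<longleftrightarrow> step_v x y"
  by (simp add: primal_iff)

lemma dual_edge_neighbour:
  "dual_edge (x, y) (x + 1, y) = {(- x, - y), (- x, - y + 1)}"
  "dual_edge (x, y) (x, y + 1) = {(- x, - y), (- x + 1, - y)}"
  "dual_edge (x, y) (x - 1, y) = {(1 - x, - y), (1 - x, - y + 1)}"
  "dual_edge (x, y) (x, y - 1) = {(- x, 1 - y), (- x + 1, 1 - y)}"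
  by (simp_all add: min_def)

lemma dual_edge_step_h:
  "{(x, y), (x + 1, y)} = dual_edge v (step v) \<longleftrightarrow> {(- x, - y), (- x, - y + 1)} = {v, step v}"
  by (rule step_cases[of v]; simp only: dual_edge_neighbour doubleton_eq_iff prod.inject; presburger)

lemma dual_edge_step_v:
  "{(x, y), (x, y + 1)} = dual_edge v (step v) \<longleftrightarrow> {(- x, - y), (- x + 1, - y)} = {v, step v}"
  by (rule step_cases[of v]; simp only: dual_edge_neighbour doubleton_eq_iff prod.inject; presburger)

lemma dual_h: "{(x, y), (x + 1, y)} \<in> range dual \<longleftrightarrow> step_v (- x) (- y)"
  unfolding dual_iff dual_edge_step_h doubleton_eq_iff step_v.simps by metis

lemma dual_v: "{(x, y), (x, y + 1)} \<in> range dual \<longleftrightarrow> step_h (- x) (- y)"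
  unfolding dual_iff dual_edge_step_v doubleton_eq_iff step_h.simps by metis

lemma lattice_edge_cases:
  assumes "e \<in> lattice_edges"
  obtains x y where "e = {(x, y), (x + 1, y)}" | x y where "e = {(x, y), (x, y + 1)}"
proof -
  obtain x y x' y' where e: "e = {(x, y), (x', y')}" and d: "\<bar>x - x'\<bar> + \<bar>y - y'\<bar> = 1"
    using assms by (auto simp: lattice_edges_def)
  from d consider "x' = x + 1" "y' = y" | "x = x' + 1" "y' = y" | "x' = x" "y' = y + 1" | "x' = x" "y = y' + 1"
    by linarith
  then show ?thesis
    using e that by cases (auto simp: insert_commute)
qed

lemma primal_dual_partition: "e \<in> lattice_edges \<Longrightarrow> e \<in> range primal \<longleftrightarrow> e \<notin> range dual"
  by (erule lattice_edge_cases)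
    (simp_all only: primal_h primal_v dual_h dual_v step_complementary minus_minus, simp)

lemma step_lattice: "{v, step v} \<in> lattice_edges"
  by (rule step_cases[of v]) (force simp: lattice_edges_def)+

lemma primal_lattice: "primal n \<in> lattice_edges"
  by (simp add: primal_def spiral_Suc step_lattice)

lemma dual_lattice: "dual n \<in> lattice_edges"
proof -
  have "dual_edge v (step v) \<in> lattice_edges" for v
    by (rule step_cases[of v]; simp only: dual_edge_neighbour) (force simp: lattice_edges_def)+
  then show ?thesis by (simp add: dual_def spiral_Suc)
qed

section \<open>Incidence of spiral edges with faces and stars\<close>

lemma horizontal_eq_iff: "{(x, y), (x + 1, y)} = {(a, b), (a + 1, b)} \<longleftrightarrow> x = a \<and> y = (b::int)"
  and vertical_eq_iff: "{(x, y), (x, y + 1)} = {(a, b), (a, b + 1)} \<longleftrightarrow> x = (a::int) \<and> y = b"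
  and horizontal_neq_vertical: "{(x, y), (x + 1, y)} \<noteq> {(a::int, b::int), (a, b + 1)}"
  for x y :: int
  by (auto simp: doubleton_eq_iff)

lemma horizontal_in_face: "{(x, y), (x + 1, y)} \<in> face_edges f \<longleftrightarrow> f = (x, y) \<or> f = (x, y - 1)"
  and vertical_in_face: "{(x, y), (x, y + 1)} \<in> face_edges f \<longleftrightarrow> f = (x, y) \<or> f = (x - 1, y)"
proof -
  note edge_eq = horizontal_eq_iff vertical_eq_iff horizontal_neq_vertical
    horizontal_neq_vertical[symmetric]
  obtain a b where f: "f = (a, b)" by (cases f)
  show "{(x, y), (x + 1, y)} \<in> face_edges f \<longleftrightarrow> f = (x, y) \<or> f = (x, y - 1)"
    "{(x, y), (x, y + 1)} \<in> face_edges f \<longleftrightarrow> f = (x, y) \<or> f = (x - 1, y)"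
    by (simp_all only: f face_edges_def prod.case insert_iff empty_iff edge_eq) auto
qed

lemma dual_in_face:
  "dual n \<in> face_edges f \<longleftrightarrow> f = - spiral n \<or> f = - spiral (Suc n)"
proof -
  have "dual_edge v (step v) \<in> face_edges f \<longleftrightarrow> f = - v \<or> f = - step v" for v
    by (rule step_cases[of v];
        simp only: dual_edge_neighbour horizontal_in_face vertical_in_face uminus_Pair; auto)
  then show ?thesis by (simp add: dual_def spiral_Suc)
qed

text \<open>If the pairs agreed crosswise, n = m + 1 and m = n + 1 would both hold.\<close>

lemma inj_path_edge:
  fixes s :: "nat \<Rightarrow> 'b"
  assumes "inj s" "{s n, s (Suc n)} = {s m, s (Suc m)}"
  shows "n = m"
  using assms by (auto simp: doubleton_eq_iff inj_eq)

definition enum_edge :: "nat + nat \<Rightarrow> edge" where "enum_edge = case_sum primal dual"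

lemma face_edges_lattice: "face_edges f \<subseteq> lattice_edges"
  by (cases f) (force simp: face_edges_def lattice_edges_def)

lemma finite_face_edges: "finite (face_edges f)"
  by (cases f) (simp add: face_edges_def)

lemma finite_star_edges: "finite (star_edges v)"
  by (cases v) (simp add: star_edges_eq)

lemma bij_enum_edge: "bij_betw enum_edge UNIV lattice_edges"
proof -
  have "dual n = dual m \<Longrightarrow> n = m" for n m
  proof -
    assume eq: "dual n = dual m"
    \<comment> \<open>A dual edge determines the two faces it separates, hence a pair of consecutive
      points of the dual path.\<close>
    have "f = - spiral n \<or> f = - spiral (Suc n) \<longleftrightarrow> f = - spiral m \<or> f = - spiral (Suc m)" for f
      using dual_in_face[of n f] dual_in_face[of m f] eq by simp
    then have "{- spiral n, - spiral (Suc n)} = {- spiral m, - spiral (Suc m)}" by blast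
    then show "n = m"
      by (rule inj_path_edge[rotated]) (auto intro!: injI dest: injD[OF inj_spiral])
  qed
  moreover have "primal n = primal m \<Longrightarrow> n = m" for n m
    unfolding primal_def by (rule inj_path_edge[OF inj_spiral])
  moreover have "primal n \<noteq> dual m" for n m
    using primal_dual_partition[OF primal_lattice, of n] by auto
  ultimately have "inj enum_edge"
    by (intro injI) (auto simp: enum_edge_def split: sum.splits, metis+)
  moreover have "range enum_edge = lattice_edges"
  proof
    show "range enum_edge \<subseteq> lattice_edges"
      by (auto simp: enum_edge_def primal_lattice dual_lattice split: sum.splits)
    show "lattice_edges \<subseteq> range enum_edge"
    proof
      fix e assume "e \<in> lattice_edges"
      then have "e \<in> range primal \<or> e \<in> range dual" using primal_dual_partition by blast
      then have "(\<exists>n. e = enum_edge (Inl n)) \<or> (\<exists>n. e = enum_edge (Inr n))"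
        by (auto simp: enum_edge_def)
      then show "e \<in> range enum_edge" by auto
    qed
  qed
  ultimately show ?thesis by (simp add: bij_betw_def)
qed

text \<open>A corner of a face lies on exactly two of its bounding edges, any other vertex on
  none.\<close>

lemma even_card_star_face: "even (card (star_edges v \<inter> face_edges f))"
proof (cases f)
  case (Pair a b)
  have "star_edges v \<inter> face_edges f = {e \<in> face_edges f. v \<in> e}"
    using face_edges_lattice[of f] by (auto simp: star_edges_def)
  also have "card \<dots> \<in> {0, 2}"
  proof -
    let ?e1 = "{(a, b), (a + 1, b)}" and ?e2 = "{(a + 1, b), (a + 1, b + 1)}"
      and ?e3 = "{(a, b + 1), (a + 1, b + 1)}" and ?e4 = "{(a, b), (a, b + 1)}"
    have "{e \<in> face_edges f. v \<in> e} =
       (if v = (a, b) then {?e1, ?e4} else if v = (a + 1, b) then {?e1, ?e2}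
        else if v = (a + 1, b + 1) then {?e2, ?e3} else if v = (a, b + 1) then {?e3, ?e4} else {})"
      by (auto simp: Pair face_edges_def)
    moreover have "?e1 \<noteq> ?e4" "?e1 \<noteq> ?e2" "?e2 \<noteq> ?e3" "?e3 \<noteq> ?e4"
      by (auto simp: doubleton_eq_iff)
    ultimately show ?thesis by auto
  qed
  finally show ?thesis by auto
qed

theorem theorem4p7:
  fixes \<iota> :: "edge set \<Rightarrow> local_op \<Rightarrow> 'a::cstar_algebra"
  assumes "quasi_local_algebra \<iota>"
  shows "cstar_diagonal (toric_diagonal \<iota>) \<and>
         cstar_diagonal (standard_diagonal \<iota>) \<and>
         automorphism_equivalent (toric_diagonal \<iota>) (standard_diagonal \<iota>)"
proof -
  interpret quasi_local_algebra \<iota> by fact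
  let ?A = "\<lambda>n. enum_edge -` star_edges (spiral n)"
  \<comment> \<open>The sign realises the rotation, so that \<open>dual m\<close> bounds exactly the
    faces numbered m and m + 1.\<close>
  let ?B = "\<lambda>n. enum_edge -` face_edges (- spiral n)"
  have inj: "inj enum_edge" and range: "range enum_edge = lattice_edges"
    using bij_enum_edge by (auto simp: bij_betw_def)
  interpret P: pauli_system "sigma_x \<iota> \<circ> enum_edge" "sigma_z \<iota> \<circ> enum_edge"
    by (rule pauli_system_sigma[OF bij_enum_edge])
  interpret T: toric_system "sigma_x \<iota> \<circ> enum_edge" "sigma_z \<iota> \<circ> enum_edge" ?A ?B
  proof
    fix n m
    show "finite (?A n)" "finite (?B n)"
      by (intro finite_vimageI finite_star_edges finite_face_edges inj)+
    show "Inl m \<in> ?A n \<longleftrightarrow> m = n \<or> n = Suc m"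
      using primal_lattice[of m]
      by (auto simp: enum_edge_def star_edges_def primal_def inj_eq[OF inj_spiral])
    show "Inr m \<in> ?B n \<longleftrightarrow> m = n \<or> n = Suc m"
      by (auto simp: enum_edge_def dual_in_face inj_eq[OF inj_spiral])
    \<comment> \<open>Passing to preimages keeps the cardinality, as the intersection consists of
      lattice edges and hence lies in the range of the injective enumeration.\<close>
    have "card (?A n \<inter> ?B m) = card (star_edges (spiral n) \<inter> face_edges (- spiral m))"
      unfolding vimage_Int[symmetric] using inj range face_edges_lattice[of "- spiral m"]
      by (intro card_vimage_inj) auto
    then show "even (card (?A n \<inter> ?B m))" by (simp add: even_card_star_face)
  qed
  have prod: "commuting_prod f S = commuting_prod (f \<circ> enum_edge) (enum_edge -` S)"
    if "commuting_family (f \<circ> enum_edge)" "finite S" "S \<subseteq> lattice_edges"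
    for f :: "edge \<Rightarrow> 'a" and S
  proof -
    have "enum_edge ` (enum_edge -` S) = S" using that(3) range by auto
    then show ?thesis
      using commuting_prod_reindex[OF inj that(1), of "enum_edge -` S"]
        finite_vimageI[OF that(2) inj] by simp
  qed
  have star: "star_op \<iota> (spiral n) = P.xp (?A n)" for n
    unfolding star_op_def
    by (rule prod[OF P.X.commuting_family_axioms finite_star_edges]) (auto simp: star_edges_def)
  have face: "face_op \<iota> (- spiral n) = P.zp (?B n)" for n
    unfolding face_op_def
    by (rule prod[OF P.Z.commuting_family_axioms finite_face_edges face_edges_lattice])
  have spiral: "range (\<lambda>n. h (spiral n)) = range h" for h :: "vertex \<Rightarrow> 'a"
  proof -
    have "range spiral = UNIV" using surj_spiral by (metis surj_def)
    then show ?thesis by (simp flip: image_image)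
  qed
  have "range (star_op \<iota>) = range (\<lambda>n. P.xp (?A n))"
    unfolding star[symmetric] by (rule spiral[symmetric])
  moreover have "range (\<lambda>v. face_op \<iota> (- v)) = range (\<lambda>n. P.zp (?B n))"
    unfolding face[symmetric] by (rule spiral[symmetric])
  then have "range (face_op \<iota>) = range (\<lambda>n. P.zp (?B n))"
    using image_image[of "face_op \<iota>" uminus UNIV] by (simp add: surj_uminus)
  ultimately have toric: "toric_diagonal \<iota> =
      cstar_subalgebra hull (range (\<lambda>n. P.xp (?A n)) \<union> range (\<lambda>n. P.zp (?B n)))"
    by (simp add: toric_diagonal_def)
  have standard: "standard_diagonal \<iota> = P.diag"
    unfolding standard_diagonal_def P.diag_def image_comp[symmetric] range ..
  show ?thesis
    unfolding toric standard using T.toric_equivalence P.cstar_diagonal_diag by blast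
qed

end
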